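(* Consider the problem $\min\{f(x):x\in X,\ g(x)\le0\}$ with a solution $x_*$. Assume that for some constants $M_f,M_g$ $$|f(x)-f(y)|\le M_f\|x-y\|_E,\qquad |g(x)-g(y)|\le M_g\|x-y\|_E\qquad\text{for all }x,y\in X,$$ and that stochastic subgradients $\nabla f(x,\xi)$, $\nabla g(x,\zeta)$ are available, which for all $x\in X$ satisfy $$\mathbb{E}[\nabla f(x,\xi)]=\nabla f(x)\in\partial f(x),\qquad \mathbb{E}[\nabla g(x,\zeta)]=\nabla g(x)\in\partial g(x),$$ $$\|\nabla f(x,\xi)\|_{E,*}\le M_f,\qquad\|\nabla g(x,\zeta)\|_{E,*}\le M_g\qquad\text{a.s. in }\xi,\zeta .$$ Let $\Theta_0>0$ be a known constant such that $V[x](y)\le\Theta_0^2$ for all $x,y\in X$ (for which $V[x](y)$ is defined), let $\varepsilon>0$ and $\sigma\in(0,0.5)$. If the Stochastic Mirror Descent algorithm (described in the context) is run with accuracy $\varepsilon$ and number of iterations $$N=\left\lceil70\,\frac{\max\{M_f^2,M_g^2\}\,\Theta_0^2}{\varepsilon^2}\,\ln\frac1\sigma\right\rceil,$$ then its output $\bar x^k$ satisfies $$\mathbb{P}\left\{f(\bar x^k)-f(x_* )\le\varepsilon,\quad g(\bar x^k)\le\varepsilon\right\}\ge1-\sigma$$ (the event includes that $\bar x^k\ne NULL$).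
   Context: **Problem.** $E$ is a finite-dimensional real vector space with norm $\|\cdot\|_E$, $E^*$ its dual, $\langle p,x\rangle$ the value of $p\in E^*$ at $x\in E$, and $\|p\|_{E,*}=\max\{\langle p,x\rangle:\|x\|_E\le1\}$. $X\subset E$ is closed and convex; $f:X\to\mathbb{R}$ and $g:E\to\mathbb{R}$ are convex. The problem is regular: there is $\bar x$ in the relative interior of $X$ with $g(\bar x)<0$. $\xi,\zeta$ are random vectors; exact values $g(x)$ can be computed. **Proximal setup.** $d$ is a prox-function: it is continuous and convex on $X$; on the set $X^0\subseteq X$ of points where a subgradient of $d$ exists it admits a continuous selection of subgradients $\nabla d(x)$; it is 1-strongly convex: $d(y)-d(x)-\langle\nabla d(x),y-x\rangle\ge\frac12\|y-x\|_E^2$ for $x\in X^0,y\in X$; and $\min_{x\in X}d(x)=0$. For $z\in X^0$, $x\in X$ the Bregman divergence is $V[z](x)=d(x)-d(z)-\langle\nabla d(z),x-z\rangle$. For $x\in X^0$, $p\in E^*$, $\mathrm{Mirr}[x](p)=\arg\min_{u\in X}\{\langle p,u\rangle+V[x](u)\}$. **Algorithm (Stochastic Mirror Descent).** Start with $x^0=\arg\min_{x\in X}d(x)$, $h=\frac{\varepsilon}{\max\{M_f^2,M_g^2\}}$, $I=\emptyset$. For $k=0,1,\dots,N-1$, using independent realizations $\xi^k$ of $\xi$ and $\zeta^k$ of $\zeta$ at each iteration: - if $g(x^k)\le\varepsilon$ (productive step): $x^{k+1}=\mathrm{Mirr}[x^k](h\nabla f(x^k,\xi^k))$ and add $k$ to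 $I$; - otherwise (non-productive step): $x^{k+1}=\mathrm{Mirr}[x^k](h\nabla g(x^k,\zeta^k))$. Output $\bar x^k=\frac1{|I|}\sum_{i\in I}x^i$ if $I\ne\emptyset$, and $\bar x^k=NULL$ otherwise. *)

theory Defs
  imports "HOL-Probability.Probability"
begin

text \<open>
  The ambient space \<open>E\<close> is a type of class \<open>euclidean_space\<close>, used only as a finite-dimensional
  real vector space with its canonical topology; the norm of \<open>E\<close> is an arbitrary function \<open>nrm\<close>
  subject to \<open>is_norm\<close> and is unrelated to the type-class norm.  The dual of \<open>E\<close> is
  \<open>'a \<Rightarrow>\<^sub>L real\<close>, i.e. all linear functionals (boundedness is automatic), with pairing
  \<open>blinfun_apply\<close>.  The Bochner integral of functional-valued maps needs the instance below.
\<close>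

lemma heine_borel_countable_basis:
  "\<exists>B :: 'a::heine_borel set set. countable B \<and> topological_basis B"
proof -
  have "\<exists>K. finite K \<and> cball a (real m) \<subseteq> (\<Union>x\<in>K. ball x (1 / Suc n))"
    for a :: 'a and m n :: nat
    using compact_eq_totally_bounded[THEN iffD1, OF compact_cball[of a "real m"]] by simp
  then obtain K :: "nat \<Rightarrow> nat \<Rightarrow> 'a set"
    where K: "finite (K m n)" "cball undefined (real m) \<subseteq> (\<Union>x\<in>K m n. ball x (1 / Suc n))" for m n
    by metis
  define D where "D = (\<Union>m n. K m n)"
  define B where "B = (\<lambda>(x, n). ball x (1 / real (Suc n))) ` (D \<times> (UNIV :: nat set))"
  have "countable D"
    unfolding D_def by (intro countable_UN countableI_type countable_finite K(1))
  then have "countable B"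
    unfolding B_def by auto
  moreover have "topological_basis B"
  proof (rule topological_basisI)
    show "open b" if "b \<in> B" for b
      using that unfolding B_def by auto
  next
    fix U :: "'a set" and y assume "open U" "y \<in> U"
    then obtain e where e: "e > 0" "ball y e \<subseteq> U"
      using open_contains_ball by blast
    obtain n where n: "1 / real (Suc n) < e / 2"
      using e(1) nat_approx_posE[of "e / 2"] by auto
    obtain m where "dist undefined y \<le> real m"
      using real_arch_simple by blast
    then obtain x where x: "x \<in> K m n" "y \<in> ball x (1 / Suc n)"
      using K(2)[of m n] by (auto simp: subset_iff)
    have "ball x (1 / real (Suc n)) \<subseteq> ball y e"
    proof
      fix z assume "z \<in> ball x (1 / real (Suc n))"
      then show "z \<in> ball y e"
        using x(2) n dist_triangle[of y z x] by (simp add: dist_commute)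
    qed
    moreover have "ball x (1 / real (Suc n)) \<in> B"
      unfolding B_def D_def using x(1) by (intro image_eqI[of _ _ "(x, n)"]) auto
    ultimately show "\<exists>b\<in>B. y \<in> b \<and> b \<subseteq> U"
      using x(2) e(2) by (meson order_trans)
  qed
  ultimately show ?thesis by blast
qed

instance blinfun :: (euclidean_space, euclidean_space) second_countable_topology
proof
  show "\<exists>B :: ('a \<Rightarrow>\<^sub>L 'b) set set. countable B \<and> open = generate_topology B"
    using heine_borel_countable_basis topological_basis_imp_subbasis by blast
qed

definition is_norm :: "('a::real_vector \<Rightarrow> real) \<Rightarrow> bool" where
  "is_norm nrm \<longleftrightarrow>
     (\<forall>x. nrm x = 0 \<longleftrightarrow> x = 0) \<and>
     (\<forall>x y. nrm (x + y) \<le> nrm x + nrm y) \<and>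
     (\<forall>c x. nrm (c *\<^sub>R x) = \<bar>c\<bar> * nrm x)"

definition dual_norm :: "('a::euclidean_space \<Rightarrow> real) \<Rightarrow> ('a \<Rightarrow>\<^sub>L real) \<Rightarrow> real" where
  "dual_norm nrm p = (SUP x\<in>{x. nrm x \<le> 1}. blinfun_apply p x)"

text \<open>
  Subdifferential at \<open>x \<in> S\<close> of a function whose domain is \<open>S\<close> (equivalently, extended by
  \<open>+\<infinity>\<close> outside \<open>S\<close>).
\<close>

definition subdifferential ::
  "'a set \<Rightarrow> ('a::euclidean_space \<Rightarrow> real) \<Rightarrow> 'a \<Rightarrow> ('a \<Rightarrow>\<^sub>L real) set" where
  "subdifferential S f x = {p. \<forall>y\<in>S. f y \<ge> f x + blinfun_apply p (y - x)}"

definition subgrad_domain :: "'a::euclidean_space set \<Rightarrow> ('a \<Rightarrow> real) \<Rightarrow> 'a set" where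
  "subgrad_domain X d = {x \<in> X. subdifferential X d x \<noteq> {}}"

definition prox_function ::
  "('a::euclidean_space \<Rightarrow> real) \<Rightarrow> 'a set \<Rightarrow> ('a \<Rightarrow> real) \<Rightarrow> ('a \<Rightarrow> 'a \<Rightarrow>\<^sub>L real) \<Rightarrow> bool" where
  "prox_function nrm X d grad_d \<longleftrightarrow>
     continuous_on X d \<and> convex_on X d \<and>
     (\<forall>x\<in>subgrad_domain X d. grad_d x \<in> subdifferential X d x) \<and>
     continuous_on (subgrad_domain X d) grad_d \<and>
     (\<forall>x\<in>subgrad_domain X d. \<forall>y\<in>X.
        d y - d x - blinfun_apply (grad_d x) (y - x) \<ge> 1 / 2 * (nrm (y - x))\<^sup>2) \<and>
     (\<exists>x. is_arg_min d (\<lambda>u. u \<in> X) x \<and> d x = 0)"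

definition bregman ::
  "('a::euclidean_space \<Rightarrow> real) \<Rightarrow> ('a \<Rightarrow> 'a \<Rightarrow>\<^sub>L real) \<Rightarrow> 'a \<Rightarrow> 'a \<Rightarrow> real" where
  "bregman d grad_d z x = d x - d z - blinfun_apply (grad_d z) (x - z)"

definition mirr ::
  "'a::euclidean_space set \<Rightarrow> ('a \<Rightarrow> real) \<Rightarrow> ('a \<Rightarrow> 'a \<Rightarrow>\<^sub>L real) \<Rightarrow> 'a \<Rightarrow> ('a \<Rightarrow>\<^sub>L real) \<Rightarrow> 'a" where
  "mirr X d grad_d x p = arg_min_on (\<lambda>u. blinfun_apply p u + bregman d grad_d x u) X"

text \<open>
  \<open>Gf x s\<close> and \<open>Gg x t\<close> are the stochastic subgradients of \<open>f\<close> and \<open>g\<close>; \<open>s k\<close> and \<open>t k\<close> are the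
  realizations of the two random vectors at iteration \<open>k\<close>; \<open>h\<close> is the step size.
\<close>

primrec smd_iterate ::
  "'a::euclidean_space set \<Rightarrow> ('a \<Rightarrow> real) \<Rightarrow> ('a \<Rightarrow> 'a \<Rightarrow>\<^sub>L real) \<Rightarrow> ('a \<Rightarrow> real) \<Rightarrow>
   ('a \<Rightarrow> 's \<Rightarrow> 'a \<Rightarrow>\<^sub>L real) \<Rightarrow> ('a \<Rightarrow> 't \<Rightarrow> 'a \<Rightarrow>\<^sub>L real) \<Rightarrow> real \<Rightarrow> real \<Rightarrow>
   (nat \<Rightarrow> 's) \<Rightarrow> (nat \<Rightarrow> 't) \<Rightarrow> nat \<Rightarrow> 'a" where
  "smd_iterate X d grad_d g Gf Gg h \<epsilon> s t 0 = arg_min_on d X"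
| "smd_iterate X d grad_d g Gf Gg h \<epsilon> s t (Suc k) =
     (let x = smd_iterate X d grad_d g Gf Gg h \<epsilon> s t k in
      if g x \<le> \<epsilon> then mirr X d grad_d x (h *\<^sub>R Gf x (s k))
      else mirr X d grad_d x (h *\<^sub>R Gg x (t k)))"

definition smd_output ::
  "'a::euclidean_space set \<Rightarrow> ('a \<Rightarrow> real) \<Rightarrow> ('a \<Rightarrow> 'a \<Rightarrow>\<^sub>L real) \<Rightarrow> ('a \<Rightarrow> real) \<Rightarrow>
   ('a \<Rightarrow> 's \<Rightarrow> 'a \<Rightarrow>\<^sub>L real) \<Rightarrow> ('a \<Rightarrow> 't \<Rightarrow> 'a \<Rightarrow>\<^sub>L real) \<Rightarrow> real \<Rightarrow> real \<Rightarrow> real \<Rightarrow> nat \<Rightarrow>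
   (nat \<Rightarrow> 's) \<Rightarrow> (nat \<Rightarrow> 't) \<Rightarrow> 'a option" where
  "smd_output X d grad_d g Gf Gg Mf Mg \<epsilon> N s t =
     (let h = \<epsilon> / max (Mf\<^sup>2) (Mg\<^sup>2);
          x = smd_iterate X d grad_d g Gf Gg h \<epsilon> s t;
          I = {k. k < N \<and> g (x k) \<le> \<epsilon>}
      in if I \<noteq> {} then Some ((1 / real (card I)) *\<^sub>R (\<Sum>i\<in>I. x i)) else None)"

end

theory Submission
  imports Defs
begin

text \<open>
  The proof compares two accounts of the run, one per sample path and one in expectation.

  On a fixed path, each mirror step trades the value of the stochastic subgradient \<open>G\<^sub>k\<close> against a
  decrease of the Bregman divergence to \<open>x_opt\<close>.  Summation telescopes, and for \<open>h = \<epsilon> / M\<^sup>2\<close> with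
  \<open>M\<^sup>2 = max {Mf\<^sup>2, Mg\<^sup>2}\<close> it gives
  \<open>(\<Sum>k<N. \<langle>G\<^sub>k, x\<^sub>k - x_opt\<rangle>) \<le> M\<^sup>2 \<Theta>\<^sup>2 / \<epsilon> + N \<epsilon> / 2\<close> (\<open>mirror_descent_regret\<close>).  If the mean
  subgradients stood in place of the \<open>G\<^sub>k\<close>, convexity would bound each summand from below by
  \<open>f x\<^sub>k - f x_opt\<close> on productive steps and by \<open>g x\<^sub>k > \<epsilon>\<close> on the others.  A bound below \<open>N \<epsilon>\<close> for the
  total then excludes that all steps are non-productive, and what is left for the productive ones is
  less than \<open>\<epsilon>\<close> on average, so that Jensen's inequality concludes (\<open>smd_output_eps_optimal\<close>).

  The price of using \<open>G\<^sub>k\<close> is the noise \<open>(\<Sum>k<N. \<langle>E G\<^sub>k - G\<^sub>k, x\<^sub>k - x_opt\<rangle>)\<close>.  It is a martingale, since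
  \<open>x\<^sub>k\<close> depends on the earlier realizations only.  Strong convexity and \<open>V[x](y) \<le> \<Theta>\<^sup>2\<close> give
  \<open>\<parallel>x\<^sub>k - x_opt\<parallel> \<le> \<surd>2 \<Theta>\<close>, so the uncentred terms lie in \<open>[-\<surd>2 M \<Theta>, \<surd>2 M \<Theta>]\<close>, and Hoeffding's lemma applied
  conditionally bounds the probability that the noise reaches \<open>t = N \<epsilon> / 2 - M\<^sup>2 \<Theta>\<^sup>2 / \<epsilon>\<close> by
  \<open>exp (- t\<^sup>2 / (4 N M\<^sup>2 \<Theta>\<^sup>2))\<close> (\<open>azuma_hoeffding_adapted\<close>).  The prescribed \<open>N\<close> makes this at most \<open>\<sigma>\<close>
  (\<open>iteration_count_suffices\<close>).

  Two points need care.  The gradient selection \<open>grad_d\<close> is one subgradient among possibly many, so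
  the first-order condition for a mirror step in terms of \<open>grad_d\<close> is not immediate; it is obtained by
  approaching the minimizer along segments from the relative interior, where subgradients exist, and
  using continuity of the selection (\<open>perturbed_min_variational\<close>).  And the iterates have to be
  measurable although they are defined by Hilbert choice; this follows because any chosen minimizer is
  Lipschitz continuous in the linear perturbation (\<open>perturbed_min_Lipschitz\<close>).
\<close>

section \<open>Norms on a Euclidean space and their duals\<close>

lemma is_norm_zero: "is_norm nrm \<Longrightarrow> nrm 0 = 0"
  and is_norm_eq_zero: "is_norm nrm \<Longrightarrow> nrm x = 0 \<longleftrightarrow> x = 0"
  and is_norm_triangle: "is_norm nrm \<Longrightarrow> nrm (x + y) \<le> nrm x + nrm y"
  and is_norm_scaleR: "is_norm nrm \<Longrightarrow> nrm (c *\<^sub>R x) = \<bar>c\<bar> * nrm x"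
  unfolding is_norm_def by blast+

lemma is_norm_minus_commute: "is_norm nrm \<Longrightarrow> nrm (x - y) = nrm (y - x)"
  using is_norm_scaleR[of nrm "-1" "y - x"] by simp

lemma is_norm_nonneg: "is_norm nrm \<Longrightarrow> nrm x \<ge> 0"
  using is_norm_triangle[of nrm x "- x"] is_norm_minus_commute[of nrm x 0]
  by (simp add: is_norm_zero)

lemma is_norm_sum_le:
  assumes "is_norm nrm" "finite A"
  shows "nrm (\<Sum>a\<in>A. v a) \<le> (\<Sum>a\<in>A. nrm (v a))"
  using assms(2)
proof (induction A rule: finite_induct)
  case empty
  show ?case using assms(1) by (simp add: is_norm_zero)
next
  case (insert a A)
  have "nrm (v a + (\<Sum>a\<in>A. v a)) \<le> nrm (v a) + nrm (\<Sum>a\<in>A. v a)"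
    using assms(1) by (rule is_norm_triangle)
  with insert show ?case by simp
qed

lemma is_norm_le_norm:
  fixes nrm :: "'a::euclidean_space \<Rightarrow> real"
  assumes "is_norm nrm"
  obtains K where "K > 0" "\<And>x. nrm x \<le> K * norm x"
proof
  define K where "K = 1 + (\<Sum>b\<in>Basis. nrm b)"
  show "K > 0"
    unfolding K_def using is_norm_nonneg[OF assms] by (intro add_pos_nonneg sum_nonneg) auto
  fix x :: 'a
  have "nrm x = nrm (\<Sum>b\<in>Basis. (x \<bullet> b) *\<^sub>R b)"
    by (simp add: euclidean_representation)
  also have "\<dots> \<le> (\<Sum>b\<in>Basis. nrm ((x \<bullet> b) *\<^sub>R b))"
    by (intro is_norm_sum_le assms finite_Basis)
  also have "\<dots> \<le> (\<Sum>b\<in>Basis. norm x * nrm b)"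
  proof (rule sum_mono)
    fix b :: 'a assume "b \<in> Basis"
    then have "nrm ((x \<bullet> b) *\<^sub>R b) = \<bar>x \<bullet> b\<bar> * nrm b" "\<bar>x \<bullet> b\<bar> \<le> norm x"
      using assms by (auto simp: is_norm_scaleR Basis_le_norm)
    then show "nrm ((x \<bullet> b) *\<^sub>R b) \<le> norm x * nrm b"
      using is_norm_nonneg[OF assms] by (simp add: mult_right_mono)
  qed
  also have "\<dots> \<le> K * norm x"
    by (simp add: K_def sum_distrib_left[symmetric] algebra_simps)
  finally show "nrm x \<le> K * norm x" .
qed

lemma is_norm_continuous:
  fixes nrm :: "'a::euclidean_space \<Rightarrow> real"
  assumes "is_norm nrm"
  shows "continuous_on A nrm"
proof -
  obtain K where K: "K > 0" "\<And>x. nrm x \<le> K * norm x"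
    using is_norm_le_norm[OF assms] by blast
  have "nrm x - nrm y \<le> nrm (x - y)" for x y
  proof -
    have "nrm ((x - y) + y) \<le> nrm (x - y) + nrm y"
      using assms by (rule is_norm_triangle)
    then show ?thesis by simp
  qed
  from this is_norm_minus_commute[OF assms]
  have "\<bar>nrm x - nrm y\<bar> \<le> nrm (x - y)" for x y
    unfolding abs_le_iff by (metis minus_diff_eq)
  then have "K-lipschitz_on A nrm"
    using K by (intro lipschitz_onI) (auto simp: dist_norm intro: order_trans)
  then show ?thesis by (rule lipschitz_on_continuous_on)
qed

text \<open>
  The minimum of \<open>nrm\<close> over the compact Euclidean unit sphere is positive, and homogeneity extends the
  resulting bound to all vectors.
\<close>

lemma norm_le_is_norm:
  fixes nrm :: "'a::euclidean_space \<Rightarrow> real"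
  assumes "is_norm nrm"
  obtains K where "K > 0" "\<And>x. norm x \<le> K * nrm x"
proof -
  have "sphere (0::'a) 1 \<noteq> {}" by simp
  then obtain z where z: "z \<in> sphere 0 1" "\<And>y. y \<in> sphere 0 1 \<Longrightarrow> nrm z \<le> nrm y"
    using continuous_attains_inf[OF compact_sphere[of 0 1] _ is_norm_continuous[OF assms]] by blast
  have "z \<noteq> 0" using z(1) by auto
  then have "nrm z \<noteq> 0" using assms by (simp add: is_norm_eq_zero)
  then have pos: "nrm z > 0" using is_norm_nonneg[OF assms, of z] by simp
  have "norm x \<le> inverse (nrm z) * nrm x" for x
  proof (cases "x = 0")
    case True
    then show ?thesis using is_norm_nonneg[OF assms, of x] pos by simp
  next
    case False
    then have "nrm z \<le> nrm (inverse (norm x) *\<^sub>R x)" by (intro z(2)) simp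
    also have "\<dots> = \<bar>inverse (norm x)\<bar> * nrm x"
      using assms by (rule is_norm_scaleR)
    finally show ?thesis using pos False by (simp add: field_simps)
  qed
  with pos show ?thesis by (intro that[of "inverse (nrm z)"]) auto
qed

lemma dual_norm_le_iff:
  fixes nrm :: "'a::euclidean_space \<Rightarrow> real"
  assumes "is_norm nrm"
  shows "dual_norm nrm p \<le> c \<longleftrightarrow> (\<forall>v. nrm v \<le> 1 \<longrightarrow> blinfun_apply p v \<le> c)"
proof -
  obtain K where K: "K > 0" "\<And>x. norm x \<le> K * nrm x"
    using norm_le_is_norm[OF assms] by blast
  have "bdd_above (blinfun_apply p ` {x. nrm x \<le> 1})"
  proof (rule bdd_aboveI2)
    fix v assume "v \<in> {x. nrm x \<le> 1}"
    have "blinfun_apply p v \<le> norm p * norm v"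
      using norm_blinfun[of p v] by simp
    also have "norm v \<le> K * 1"
      using \<open>v \<in> _\<close> K order_trans[OF K(2) mult_left_mono[of "nrm v" 1 K]] by auto
    finally show "blinfun_apply p v \<le> norm p * K" by (simp add: mult_left_mono)
  qed
  moreover have "{x. nrm x \<le> 1} \<noteq> {}"
  proof -
    have "nrm 0 \<le> 1" using assms by (simp add: is_norm_zero)
    then show ?thesis by blast
  qed
  ultimately show ?thesis
    unfolding dual_norm_def by (subst cSUP_le_iff) auto
qed

lemma dual_norm_pairing:
  fixes nrm :: "'a::euclidean_space \<Rightarrow> real"
  assumes "is_norm nrm" and "dual_norm nrm p \<le> c"
  shows "\<bar>blinfun_apply p v\<bar> \<le> c * nrm v"
proof (cases "v = 0")
  case True
  then show ?thesis using assms(1) by (simp add: is_norm_zero)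
next
  case False
  then have "nrm v \<noteq> 0" using assms(1) by (simp add: is_norm_eq_zero)
  then have pos: "nrm v > 0" using is_norm_nonneg[OF assms(1), of v] by simp
  have "blinfun_apply p (s *\<^sub>R v) \<le> c" if "\<bar>s\<bar> = inverse (nrm v)" for s
  proof -
    have "nrm (s *\<^sub>R v) = \<bar>s\<bar> * nrm v"
      using assms(1) by (rule is_norm_scaleR)
    then show ?thesis using assms pos that by (simp add: dual_norm_le_iff)
  qed
  from this[of "inverse (nrm v)"] this[of "- inverse (nrm v)"] pos
  show ?thesis by (simp add: blinfun.scaleR_right blinfun.minus_right field_simps abs_le_iff)
qed

text \<open>
  Closedness makes the bound on a stochastic subgradient a measurable event.
\<close>

lemma closed_dual_norm_le:
  fixes nrm :: "'a::euclidean_space \<Rightarrow> real"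
  assumes "is_norm nrm"
  shows "closed {p. dual_norm nrm p \<le> c}"
proof -
  have "{p. dual_norm nrm p \<le> c} = (\<Inter>v\<in>{v. nrm v \<le> 1}. {p. blinfun_apply p v \<le> c})"
    using assms by (auto simp: dual_norm_le_iff)
  moreover have "closed {p :: 'a \<Rightarrow>\<^sub>L real. blinfun_apply p v \<le> c}" for v
    by (intro closed_Collect_le continuous_intros)
  ultimately show ?thesis by auto
qed

section \<open>Mirror steps and their regret\<close>

text \<open>
  A supporting hyperplane of the epigraph at \<open>(z, d z)\<close> has a subgradient as its slope once it is
  known not to be vertical.
\<close>

lemma subgradient_exists_rel_interior:
  fixes d :: "'a::euclidean_space \<Rightarrow> real"
  assumes X: "convex X" and d: "convex_on X d" and z: "z \<in> rel_interior X"
  shows "z \<in> subgrad_domain X d"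
proof -
  have zX: "z \<in> X" using z rel_interior_subset by blast
  let ?C = "epigraph X d"
  have C: "convex ?C" using d by (rule convex_epigraphI)
  have zC: "(z, d z) \<in> ?C" using zX by (simp add: mem_epigraph)
  have "(z, d z) \<notin> rel_interior ?C"
  proof
    assume "(z, d z) \<in> rel_interior ?C"
    moreover have "(z, d z + 1) \<in> ?C" using zX by (simp add: mem_epigraph)
    ultimately obtain e where e: "e > 1" "(1 - e) *\<^sub>R (z, d z + 1) + e *\<^sub>R (z, d z) \<in> ?C"
      using convex_rel_interior_iff[OF C] zC by blast
    have "(1 - e) *\<^sub>R (z, d z + 1) + e *\<^sub>R (z, d z) = (z, d z + (1 - e))"
      by (auto simp: algebra_simps simp flip: scaleR_add_left)
    with e show False by (simp add: mem_epigraph)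
  qed
  from supporting_hyperplane_rel_boundary[OF C zC this]
  obtain a where a: "a \<noteq> 0" "\<And>y. y \<in> ?C \<Longrightarrow> a \<bullet> (z, d z) \<le> a \<bullet> y"
    and a_strict: "\<And>y. y \<in> rel_interior ?C \<Longrightarrow> a \<bullet> (z, d z) < a \<bullet> y"
    by blast
  obtain v s where vs: "a = (v, s)" by (cases a)
  have "s \<ge> 0"
    using a(2)[of "(z, d z + 1)"] zX by (simp add: mem_epigraph vs inner_prod_def distrib_left)
  \<comment> \<open>For \<open>s = 0\<close> the form \<open>v\<close>, not constant on \<open>X\<close>, would attain its minimum at the relative interior point \<open>z\<close>.\<close>
  moreover have "s \<noteq> 0"
  proof
    assume s: "s = 0"
    have "rel_interior ?C \<noteq> {}"
      using rel_interior_eq_empty[OF C] zC by blast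
    then obtain y r where yr: "(y, r) \<in> rel_interior ?C" by auto
    then have y: "y \<in> X" using rel_interior_subset[of ?C] by (auto simp: mem_epigraph)
    have less: "v \<bullet> z < v \<bullet> y"
      using a_strict[OF yr] by (simp add: vs s inner_prod_def)
    obtain e where e: "e > 1" "(1 - e) *\<^sub>R y + e *\<^sub>R z \<in> X"
      using convex_rel_interior_iff[OF X] z y by blast
    have "v \<bullet> z \<le> v \<bullet> ((1 - e) *\<^sub>R y + e *\<^sub>R z)"
      using a(2)[of "((1 - e) *\<^sub>R y + e *\<^sub>R z, d ((1 - e) *\<^sub>R y + e *\<^sub>R z))"] e(2)
      by (simp add: mem_epigraph vs s inner_prod_def)
    then have "(e - 1) * (v \<bullet> y) \<le> (e - 1) * (v \<bullet> z)"
      by (simp add: inner_add_right algebra_simps)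
    with e(1) less show False by simp
  qed
  ultimately have s: "s > 0" by simp
  define p where "p = Blinfun (\<lambda>w. - (v \<bullet> w) / s)"
  have p: "blinfun_apply p w = - (v \<bullet> w) / s" for w
  proof -
    have "bounded_linear (\<lambda>w. (- v /\<^sub>R s) \<bullet> w)" by (rule bounded_linear_inner_right)
    then have "bounded_linear (\<lambda>w. - (v \<bullet> w) / s)" by (simp add: field_simps)
    then show ?thesis by (simp add: p_def bounded_linear_Blinfun_apply)
  qed
  have "d y \<ge> d z + blinfun_apply p (y - z)" if "y \<in> X" for y
  proof -
    have "v \<bullet> z + s * d z \<le> v \<bullet> y + s * d y"
      using a(2)[of "(y, d y)"] that by (simp add: mem_epigraph vs inner_prod_def)
    then show ?thesis using s by (simp add: p inner_diff_right field_simps)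
  qed
  then show ?thesis
    unfolding subgrad_domain_def subdifferential_def using zX by auto
qed

text \<open>
  The bound on the Bregman divergence makes the feasible set compact, so that every minimization
  problem defining a mirror step has a solution.
\<close>

locale bounded_prox_setup =
  fixes nrm :: "'a::euclidean_space \<Rightarrow> real" and X :: "'a set"
    and d :: "'a \<Rightarrow> real" and grad_d :: "'a \<Rightarrow> 'a \<Rightarrow>\<^sub>L real" and \<Theta> :: real
  assumes nrm: "is_norm nrm"
    and X: "closed X" "convex X"
    and prox: "prox_function nrm X d grad_d"
    and \<Theta>: "\<Theta> > 0" "\<And>x y. x \<in> subgrad_domain X d \<Longrightarrow> y \<in> X \<Longrightarrow> bregman d grad_d x y \<le> \<Theta>\<^sup>2"
begin

lemma d_continuous: "continuous_on X d"
  and d_convex: "convex_on X d"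
  and grad_continuous: "continuous_on (subgrad_domain X d) grad_d"
  and X_nonempty: "X \<noteq> {}"
  and bregman_ge: "x \<in> subgrad_domain X d \<Longrightarrow> y \<in> X \<Longrightarrow>
    bregman d grad_d x y \<ge> 1 / 2 * (nrm (y - x))\<^sup>2"
  using prox by (auto simp: prox_function_def is_arg_min_def bregman_def)

lemma subgrad_domain_subset: "subgrad_domain X d \<subseteq> X"
  by (auto simp: subgrad_domain_def)

lemma bregman_nonneg:
  "x \<in> subgrad_domain X d \<Longrightarrow> y \<in> X \<Longrightarrow> bregman d grad_d x y \<ge> 0"
  using bregman_ge[of x y] by (meson order_trans zero_le_power2 mult_nonneg_nonneg zero_le_divide_1_iff zero_le_numeral)

lemma diameter_le:
  assumes "x \<in> subgrad_domain X d" "y \<in> X"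
  shows "nrm (x - y) \<le> sqrt 2 * \<Theta>"
proof (rule power2_le_imp_le)
  have "1 / 2 * (nrm (y - x))\<^sup>2 \<le> \<Theta>\<^sup>2"
    using bregman_ge[OF assms] \<Theta>(2)[OF assms] by linarith
  then show "(nrm (x - y))\<^sup>2 \<le> (sqrt 2 * \<Theta>)\<^sup>2"
    by (simp add: is_norm_minus_commute[OF nrm, of x y] power_mult_distrib)
  show "0 \<le> sqrt 2 * \<Theta>" using \<Theta> by simp
qed

lemma rel_interior_nonempty: "rel_interior X \<noteq> {}"
  using rel_interior_eq_empty[OF X(2)] X_nonempty by blast

lemma X_compact: "compact X"
proof -
  obtain z where "z \<in> rel_interior X" using rel_interior_nonempty by blast
  then have z: "z \<in> subgrad_domain X d"
    by (rule subgradient_exists_rel_interior[OF X(2) d_convex])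
  obtain K where K: "K > 0" "\<And>x. norm x \<le> K * nrm x"
    using norm_le_is_norm[OF nrm] by blast
  have "X \<subseteq> cball z (K * (sqrt 2 * \<Theta>))"
  proof
    fix y assume "y \<in> X"
    then have "K * nrm (z - y) \<le> K * (sqrt 2 * \<Theta>)"
      using diameter_le[OF z] K(1) by (intro mult_left_mono) auto
    then show "y \<in> cball z (K * (sqrt 2 * \<Theta>))"
      using K(2)[of "z - y"] by (simp add: dist_norm)
  qed
  then show ?thesis
    using X(1) bounded_cball bounded_subset compact_eq_bounded_closed by blast
qed

text \<open>
  Starting point and mirror steps are all minimizers of \<open>d\<close> plus a linear functional, so their
  analysis reduces to that of the map \<open>perturbed_min\<close>.
\<close>

definition perturbed_min :: "('a \<Rightarrow>\<^sub>L real) \<Rightarrow> 'a" where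
  "perturbed_min q = arg_min_on (\<lambda>u. d u + blinfun_apply q u) X"

lemma perturbed_min_minimizes:
  "perturbed_min q \<in> X"
  "y \<in> X \<Longrightarrow> d (perturbed_min q) + blinfun_apply q (perturbed_min q) \<le> d y + blinfun_apply q y"
proof -
  have "continuous_on X (\<lambda>u. d u + blinfun_apply q u)"
    by (intro continuous_intros d_continuous)
  from continuous_attains_inf[OF X_compact X_nonempty this]
  have "\<exists>u. is_arg_min (\<lambda>u. d u + blinfun_apply q u) (\<lambda>u. u \<in> X) u"
    by (auto simp: is_arg_min_linorder)
  then have "is_arg_min (\<lambda>u. d u + blinfun_apply q u) (\<lambda>u. u \<in> X) (perturbed_min q)"
    unfolding perturbed_min_def arg_min_on_def arg_min_def by (rule someI_ex)
  then show "perturbed_min q \<in> X"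
    "y \<in> X \<Longrightarrow> d (perturbed_min q) + blinfun_apply q (perturbed_min q) \<le> d y + blinfun_apply q y"
    by (auto simp: is_arg_min_linorder)
qed

lemma minus_subgradient_perturbed_min: "- q \<in> subdifferential X d (perturbed_min q)"
  using perturbed_min_minimizes(2)[of _ q]
  by (auto simp: subdifferential_def blinfun.minus_left blinfun.diff_right algebra_simps)

lemma perturbed_min_subgrad_domain: "perturbed_min q \<in> subgrad_domain X d"
  using perturbed_min_minimizes(1) minus_subgradient_perturbed_min
  unfolding subgrad_domain_def by blast

text \<open>
  Optimality of \<open>u\<close> says that \<open>-q\<close> is a subgradient of \<open>d\<close> at \<open>u\<close>, but \<open>grad_d u\<close> may be a different
  one, so the condition has to be carried over.  For \<open>y\<close> in the relative interior of \<open>X\<close> the points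
  \<open>z\<^sub>n\<close> between \<open>u\<close> and \<open>y\<close> admit subgradients; comparing \<open>d u\<close> with the linearization at \<open>z\<^sub>n\<close> and using
  that \<open>u\<close> minimizes yields the inequality with \<open>grad_d z\<^sub>n\<close> in place of \<open>grad_d u\<close>.  Continuity of \<open>grad_d\<close>
  allows \<open>n \<rightarrow> \<infinity>\<close>, and density of the relative interior covers the remaining \<open>y\<close>.
\<close>

lemma perturbed_min_variational:
  assumes "y \<in> X"
  shows "blinfun_apply (grad_d (perturbed_min q) + q) (y - perturbed_min q) \<ge> 0"
proof -
  let ?u = "perturbed_min q"
  have u: "?u \<in> subgrad_domain X d" "?u \<in> X"
    using perturbed_min_subgrad_domain perturbed_min_minimizes(1) by auto
  have interior: "blinfun_apply (grad_d ?u + q) (y - ?u) \<ge> 0" if y: "y \<in> rel_interior X" for y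
  proof -
    define z where "z n = ?u - inverse (real (Suc n)) *\<^sub>R (?u - y)" for n
    have z_rel: "z n \<in> rel_interior X" for n
      unfolding z_def
      by (intro rel_interior_convex_shrink[OF X(2) y u(2)]) (auto simp: field_simps)
    then have z: "z n \<in> subgrad_domain X d" for n
      by (rule subgradient_exists_rel_interior[OF X(2) d_convex])
    have "z \<longlonglongrightarrow> ?u - 0 *\<^sub>R (?u - y)"
      unfolding z_def by (intro tendsto_intros LIMSEQ_inverse_real_of_nat)
    then have "z \<longlonglongrightarrow> ?u" by simp
    then have "(\<lambda>n. grad_d (z n)) \<longlonglongrightarrow> grad_d ?u"
      using grad_continuous u(1) z by (intro continuous_on_tendsto_compose[OF grad_continuous]) auto
    then have lim: "(\<lambda>n. blinfun_apply (grad_d (z n) + q) (y - ?u)) \<longlonglongrightarrow> blinfun_apply (grad_d ?u + q) (y - ?u)"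
      by (intro tendsto_intros)
    have "blinfun_apply (grad_d (z n) + q) (y - ?u) \<ge> 0" for n
    proof -
      have zX: "z n \<in> X" using z subgrad_domain_subset by blast
      have "d ?u - d (z n) \<ge> blinfun_apply (grad_d (z n)) (?u - z n)"
        using bregman_nonneg[OF z u(2), of n] by (simp add: bregman_def)
      moreover have "d (z n) + blinfun_apply q (z n) \<ge> d ?u + blinfun_apply q ?u"
        by (rule perturbed_min_minimizes(2)[OF zX])
      ultimately have "blinfun_apply (grad_d (z n) + q) (z n - ?u) \<ge> 0"
        by (simp add: blinfun.add_left blinfun.diff_right)
      moreover have "z n - ?u = inverse (real (Suc n)) *\<^sub>R (y - ?u)"
        by (simp add: z_def algebra_simps)
      ultimately have "inverse (real (Suc n)) * blinfun_apply (grad_d (z n) + q) (y - ?u) \<ge> 0"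
        by (simp only: blinfun.scaleR_right real_scaleR_def)
      then show ?thesis by (simp add: zero_le_mult_iff)
    qed
    then show ?thesis by (intro LIMSEQ_le_const[OF lim]) auto
  qed
  have "closed {y. blinfun_apply (grad_d ?u + q) (y - ?u) \<ge> 0}"
    by (intro closed_Collect_le continuous_intros)
  then have "closure (rel_interior X) \<subseteq> {y. blinfun_apply (grad_d ?u + q) (y - ?u) \<ge> 0}"
    using interior by (intro closure_minimal) auto
  then show ?thesis
    using assms convex_closure_rel_interior[OF X(2)] X(1) by (auto simp: closure_closed)
qed

text \<open>
  Strong convexity at the minimizers \<open>u\<close> and \<open>u'\<close> for \<open>q\<close> and \<open>q'\<close> gives
  \<open>\<parallel>u - u'\<parallel>\<^sup>2 \<le> \<langle>q' - q, u - u'\<rangle>\<close>.  The map is continuous whichever minimizers the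
  choice operator picks, which is what makes mirror steps measurable.
\<close>

lemma perturbed_min_Lipschitz:
  obtains L where "L-lipschitz_on UNIV perturbed_min"
proof -
  obtain K where K: "K > 0" "\<And>x. norm x \<le> K * nrm x"
    using norm_le_is_norm[OF nrm] by blast
  have "dist (perturbed_min q) (perturbed_min q') \<le> K\<^sup>2 * dist q q'" for q q'
  proof -
    let ?u = "perturbed_min q" and ?u' = "perturbed_min q'"
    define r where "r = norm (?u - ?u')"
    note dom = perturbed_min_subgrad_domain
    note inX = perturbed_min_minimizes(1)
    have "r\<^sup>2 \<le> K\<^sup>2 * (nrm (?u - ?u'))\<^sup>2"
      using K(2)[of "?u - ?u'"] by (simp add: r_def power_mult_distrib[symmetric] power_mono)
    moreover have "(nrm (?u - ?u'))\<^sup>2 \<le> blinfun_apply (q' - q) (?u - ?u')"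
    proof -
      have "d ?u' - d ?u + blinfun_apply q (?u' - ?u) \<ge> 1 / 2 * (nrm (?u' - ?u))\<^sup>2"
        using bregman_ge[OF dom[of q] inX[of q']] perturbed_min_variational[OF inX[of q'], of q]
        by (simp add: bregman_def blinfun.add_left)
      moreover have "d ?u - d ?u' + blinfun_apply q' (?u - ?u') \<ge> 1 / 2 * (nrm (?u - ?u'))\<^sup>2"
        using bregman_ge[OF dom[of q'] inX[of q]] perturbed_min_variational[OF inX[of q], of q']
        by (simp add: bregman_def blinfun.add_left)
      ultimately show ?thesis
        by (simp add: is_norm_minus_commute[OF nrm, of ?u' ?u] blinfun.diff_left blinfun.diff_right)
    qed
    moreover have "blinfun_apply (q' - q) (?u - ?u') \<le> dist q q' * r"
      using norm_blinfun[of "q' - q" "?u - ?u'"] by (simp add: r_def dist_norm norm_minus_commute)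
    ultimately have "r\<^sup>2 \<le> K\<^sup>2 * (dist q q' * r)"
      by (meson mult_left_mono order_trans zero_le_power2)
    then have "r * r \<le> (K\<^sup>2 * dist q q') * r"
      by (simp add: power2_eq_square mult.assoc)
    then have "r \<le> K\<^sup>2 * dist q q'"
      by (cases "r > 0") (auto simp: r_def)
    then show ?thesis by (simp add: r_def dist_norm)
  qed
  then have "(K\<^sup>2)-lipschitz_on UNIV perturbed_min"
    by (intro lipschitz_onI) auto
  then show ?thesis by (rule that)
qed

lemma mirr_eq_perturbed_min: "mirr X d grad_d x p = perturbed_min (p - grad_d x)"
proof -
  have "is_arg_min (\<lambda>u. blinfun_apply p u + bregman d grad_d x u) P
    = is_arg_min (\<lambda>u. d u + blinfun_apply (p - grad_d x) u) P" for P
    by (auto simp: fun_eq_iff is_arg_min_def bregman_def blinfun.diff_left blinfun.diff_right)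
  then show ?thesis
    unfolding mirr_def perturbed_min_def arg_min_on_def arg_min_def by simp
qed

lemma start_eq_perturbed_min: "arg_min_on d X = perturbed_min 0"
  by (simp add: perturbed_min_def)

lemma mirr_subgrad_domain: "mirr X d grad_d x p \<in> subgrad_domain X d"
  by (simp add: mirr_eq_perturbed_min perturbed_min_subgrad_domain)

lemma mirr_measurable:
  "(\<lambda>(x, p). mirr X d grad_d x p)
    \<in> restrict_space borel (subgrad_domain X d) \<Otimes>\<^sub>M borel \<rightarrow>\<^sub>M restrict_space borel (subgrad_domain X d)"
proof -
  obtain L where "L-lipschitz_on UNIV perturbed_min" by (rule perturbed_min_Lipschitz)
  then have [measurable]: "perturbed_min \<in> borel_measurable borel"
    by (intro borel_measurable_continuous_onI lipschitz_on_continuous_on)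
  have [measurable]: "grad_d \<in> borel_measurable (restrict_space borel (subgrad_domain X d))"
    by (rule borel_measurable_continuous_on_restrict[OF grad_continuous])
  show ?thesis
    by (rule measurable_restrict_space2)
      (auto simp: mirr_eq_perturbed_min perturbed_min_subgrad_domain)
qed

text \<open>
  With \<open>u\<close> the new point, the first-order condition gives the three-point inequality
  \<open>\<langle>p, u - y\<rangle> \<le> V[x](y) - V[u](y) - V[x](u)\<close>, and the last term absorbs \<open>\<langle>p, x - u\<rangle>\<close> by
  \<open>c \<parallel>u - x\<parallel> \<le> c\<^sup>2 / 2 + \<parallel>u - x\<parallel>\<^sup>2 / 2\<close> and strong convexity.
\<close>

lemma mirr_step:
  assumes x: "x \<in> subgrad_domain X d" and y: "y \<in> X"
    and p: "\<And>v. \<bar>blinfun_apply p v\<bar> \<le> c * nrm v"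
  shows "blinfun_apply p (x - y)
    \<le> bregman d grad_d x y - bregman d grad_d (mirr X d grad_d x p) y + c\<^sup>2 / 2"
proof -
  define u where "u = mirr X d grad_d x p"
  have u: "u \<in> X"
    using mirr_subgrad_domain subgrad_domain_subset unfolding u_def by blast
  have "blinfun_apply (grad_d u + (p - grad_d x)) (y - u) \<ge> 0"
    using perturbed_min_variational[OF y] unfolding u_def mirr_eq_perturbed_min .
  then have "blinfun_apply p (u - y)
    \<le> bregman d grad_d x y - bregman d grad_d u y - bregman d grad_d x u"
    by (simp add: bregman_def blinfun.add_left blinfun.diff_left blinfun.diff_right)
  moreover have "blinfun_apply p (x - u) \<le> c\<^sup>2 / 2 + bregman d grad_d x u"
  proof -
    have "blinfun_apply p (x - u) \<le> c * nrm (u - x)"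
      using p[of "x - u"] by (simp add: is_norm_minus_commute[OF nrm, of x u])
    also have "\<dots> \<le> c\<^sup>2 / 2 + 1 / 2 * (nrm (u - x))\<^sup>2"
      using sum_squares_bound[of c "nrm (u - x)"] by simp
    finally show ?thesis using bregman_ge[OF x u] by linarith
  qed
  ultimately show ?thesis
    unfolding u_def[symmetric] by (simp add: blinfun.diff_right)
qed

text \<open>
  The divergences \<open>V[x\<^sub>k](y)\<close> telescope; the first is at most \<open>\<Theta>\<^sup>2\<close> and the last is nonnegative.
\<close>

lemma mirror_descent_regret:
  assumes dom: "\<And>k. x k \<in> subgrad_domain X d"
    and step: "\<And>k. k < N \<Longrightarrow> x (Suc k) = mirr X d grad_d (x k) (h *\<^sub>R p k)"
    and p: "\<And>k v. k < N \<Longrightarrow> \<bar>blinfun_apply (p k) v\<bar> \<le> c * nrm v"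
    and y: "y \<in> X" and h: "h > 0"
  shows "(\<Sum>k<N. blinfun_apply (p k) (x k - y)) \<le> \<Theta>\<^sup>2 / h + real N * (h * c\<^sup>2 / 2)"
proof -
  let ?V = "\<lambda>k. bregman d grad_d (x k) y"
  have "h * blinfun_apply (p k) (x k - y) \<le> ?V k - ?V (Suc k) + (h * c)\<^sup>2 / 2" if "k < N" for k
  proof -
    have "\<bar>blinfun_apply (h *\<^sub>R p k) v\<bar> \<le> (h * c) * nrm v" for v
      using p[OF that, of v] h by (simp add: blinfun.scaleR_left abs_mult)
    from mirr_step[OF dom y this] show ?thesis
      unfolding step[OF that] by (simp add: blinfun.scaleR_left)
  qed
  then have "(\<Sum>k<N. h * blinfun_apply (p k) (x k - y)) \<le> (\<Sum>k<N. ?V k - ?V (Suc k) + (h * c)\<^sup>2 / 2)"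
    by (intro sum_mono) simp
  also have "\<dots> = ?V 0 - ?V N + real N * ((h * c)\<^sup>2 / 2)"
    using sum_lessThan_telescope'[of ?V N] by (simp add: sum.distrib)
  also have "\<dots> \<le> \<Theta>\<^sup>2 + real N * ((h * c)\<^sup>2 / 2)"
    using \<Theta>(2)[OF dom[of 0] y] bregman_nonneg[OF dom[of N] y] by simp
  finally have "h * (\<Sum>k<N. blinfun_apply (p k) (x k - y)) \<le> \<Theta>\<^sup>2 + real N * ((h * c)\<^sup>2 / 2)"
    by (simp add: sum_distrib_left)
  also have "\<dots> = h * (\<Theta>\<^sup>2 / h + real N * (h * c\<^sup>2 / 2))"
    using h by (simp add: field_simps power2_eq_square)
  finally show ?thesis using h by simp
qed

end

section \<open>Averages of nearly optimal points\<close>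

lemma average_in_convex:
  fixes x :: "'i \<Rightarrow> 'a::real_vector"
  assumes "finite I" "I \<noteq> {}" "convex C" "\<And>i. i \<in> I \<Longrightarrow> x i \<in> C"
  shows "(1 / real (card I)) *\<^sub>R (\<Sum>i\<in>I. x i) \<in> C"
  using convex_sum[OF assms(1,3), of "\<lambda>_. 1 / real (card I)" x] assms
  by (simp add: scaleR_sum_right)

lemma convex_on_average:
  fixes x :: "'i \<Rightarrow> 'a::real_vector"
  assumes "finite I" "I \<noteq> {}" "convex_on C f" "\<And>i. i \<in> I \<Longrightarrow> x i \<in> C"
    and "(\<Sum>i\<in>I. f (x i)) \<le> real (card I) * c"
  shows "f ((1 / real (card I)) *\<^sub>R (\<Sum>i\<in>I. x i)) \<le> c"
proof -
  have "f ((1 / real (card I)) *\<^sub>R (\<Sum>i\<in>I. x i)) \<le> (\<Sum>i\<in>I. 1 / real (card I) * f (x i))"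
    using convex_on_sum[OF assms(1-3), of "\<lambda>_. 1 / real (card I)" x] assms
    by (simp add: scaleR_sum_right)
  also have "\<dots> = (\<Sum>i\<in>I. f (x i)) / real (card I)"
    by (simp add: sum_divide_distrib)
  also have "\<dots> \<le> c"
    using assms by (simp add: field_simps card_gt_0_iff)
  finally show ?thesis .
qed

text \<open>
  Non-productive steps contribute at least \<open>\<epsilon>\<close> each to the total gap, so a total below \<open>N \<epsilon>\<close> leaves less
  than \<open>\<epsilon>\<close> per productive step; in particular a productive step exists.
\<close>

lemma smd_output_eps_optimal:
  fixes f g :: "'a::euclidean_space \<Rightarrow> real"
  assumes X: "convex X" and f: "convex_on X f" and g: "convex_on UNIV g"
    and x: "x = smd_iterate X d grad_d g Gf Gg (\<epsilon> / max (Mf\<^sup>2) (Mg\<^sup>2)) \<epsilon> s t"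
    and inX: "\<And>k. x k \<in> X"
    and gap: "(\<Sum>k<N. if g (x k) \<le> \<epsilon> then f (x k) - f z else g (x k)) < real N * \<epsilon>"
  shows "\<exists>x_bar. smd_output X d grad_d g Gf Gg Mf Mg \<epsilon> N s t = Some x_bar \<and>
    f x_bar - f z \<le> \<epsilon> \<and> g x_bar \<le> \<epsilon>"
proof -
  define I where "I = {k. k < N \<and> g (x k) \<le> \<epsilon>}"
  define J where "J = {k. k < N \<and> g (x k) > \<epsilon>}"
  have [simp]: "finite I" "finite J" by (auto simp: I_def J_def)
  have IJ: "{..<N} = I \<union> J" "I \<inter> J = {}" by (auto simp: I_def J_def)
  have card: "real N = real (card I) + real (card J)"
    using card_Un_disjoint[of I J] IJ by (metis \<open>finite I\<close> \<open>finite J\<close> card_lessThan of_nat_add)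
  have "(\<Sum>k<N. if g (x k) \<le> \<epsilon> then f (x k) - f z else g (x k))
    = (\<Sum>k\<in>I. f (x k) - f z) + (\<Sum>k\<in>J. g (x k))"
    unfolding IJ(1) using IJ(2)
    by (subst sum.union_disjoint) (auto simp: I_def J_def intro!: arg_cong2[of _ _ _ _ "(+)"] sum.cong)
  moreover have "real (card J) * \<epsilon> \<le> (\<Sum>k\<in>J. g (x k))"
    using sum_bounded_below[of J \<epsilon> "\<lambda>k. g (x k)"] by (auto simp: J_def)
  ultimately have less: "(\<Sum>k\<in>I. f (x k) - f z) < real (card I) * \<epsilon>"
    using gap card by (simp add: algebra_simps)
  then have "I \<noteq> {}" by auto
  let ?m = "(1 / real (card I)) *\<^sub>R (\<Sum>i\<in>I. x i)"
  have "smd_output X d grad_d g Gf Gg Mf Mg \<epsilon> N s t = Some ?m"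
    using \<open>I \<noteq> {}\<close> unfolding smd_output_def Let_def x[symmetric] I_def[symmetric] by simp
  moreover have "f ?m \<le> f z + \<epsilon>"
  proof (rule convex_on_average[OF _ \<open>I \<noteq> {}\<close> f inX])
    show "(\<Sum>i\<in>I. f (x i)) \<le> real (card I) * (f z + \<epsilon>)"
      using less by (simp add: sum_subtractf algebra_simps)
  qed simp
  moreover have "g ?m \<le> \<epsilon>"
  proof (rule convex_on_average[OF _ \<open>I \<noteq> {}\<close> g])
    show "(\<Sum>i\<in>I. g (x i)) \<le> real (card I) * \<epsilon>"
      by (rule sum_bounded_above) (auto simp: I_def)
  qed auto
  ultimately show ?thesis by auto
qed

section \<open>Measurability of the iterates and of the output\<close>

lemma smd_iterate_cong:
  assumes "\<And>j. j < k \<Longrightarrow> s j = s' j" "\<And>j. j < k \<Longrightarrow> t j = t' j"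
  shows "smd_iterate X d grad_d g Gf Gg h \<epsilon> s t k = smd_iterate X d grad_d g Gf Gg h \<epsilon> s' t' k"
  using assms by (induction k) (auto simp: Let_def)

lemma restrict_space_borel_mono_measurable:
  assumes "F \<in> M \<rightarrow>\<^sub>M restrict_space borel A" "A \<subseteq> B"
  shows "F \<in> M \<rightarrow>\<^sub>M restrict_space borel B"
  using assms by (auto simp: measurable_restrict_space2_iff)

lemma borel_measurable_blinfun_apply:
  fixes F :: "'m \<Rightarrow> 'a::euclidean_space \<Rightarrow>\<^sub>L real"
  assumes "F \<in> borel_measurable M" "v \<in> borel_measurable M"
  shows "(\<lambda>\<omega>. blinfun_apply (F \<omega>) (v \<omega>)) \<in> borel_measurable M"
  by (rule borel_measurable_continuous_Pair[OF assms]) (intro continuous_intros)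

lemma measurable_random_point:
  assumes G: "(\<lambda>(x, s). G x s) \<in> borel_measurable (restrict_space borel X \<Otimes>\<^sub>M S)"
    and x: "x \<in> M \<rightarrow>\<^sub>M restrict_space borel X" and s: "s \<in> M \<rightarrow>\<^sub>M S"
  shows "(\<lambda>\<omega>. G (x \<omega>) (s \<omega>)) \<in> borel_measurable M"
  using measurable_compose[OF measurable_Pair[OF x s] G] by simp

context bounded_prox_setup
begin

lemma smd_iterate_subgrad_domain: "smd_iterate X d grad_d g Gf Gg h \<epsilon> s t k \<in> subgrad_domain X d"
  by (cases k) (auto simp: Let_def start_eq_perturbed_min perturbed_min_subgrad_domain mirr_subgrad_domain)

lemma smd_iterate_in_X: "smd_iterate X d grad_d g Gf Gg h \<epsilon> s t k \<in> X"
  using smd_iterate_subgrad_domain subgrad_domain_subset by blast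

lemma smd_iterate_measurable:
  assumes g: "g \<in> borel_measurable borel"
    and Gf: "(\<lambda>(x, s). Gf x s) \<in> borel_measurable (restrict_space borel X \<Otimes>\<^sub>M S)"
    and Gg: "(\<lambda>(x, t). Gg x t) \<in> borel_measurable (restrict_space borel X \<Otimes>\<^sub>M T)"
    and s: "\<And>j. j < k \<Longrightarrow> (\<lambda>\<omega>. s \<omega> j) \<in> M \<rightarrow>\<^sub>M S"
    and t: "\<And>j. j < k \<Longrightarrow> (\<lambda>\<omega>. t \<omega> j) \<in> M \<rightarrow>\<^sub>M T"
  shows "(\<lambda>\<omega>. smd_iterate X d grad_d g Gf Gg h \<epsilon> (s \<omega>) (t \<omega>) k)
    \<in> M \<rightarrow>\<^sub>M restrict_space borel (subgrad_domain X d)"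
  using s t
proof (induction k)
  case 0
  show ?case
    by (auto simp: measurable_restrict_space2_iff start_eq_perturbed_min perturbed_min_subgrad_domain)
next
  case (Suc k)
  define x where "x \<omega> = smd_iterate X d grad_d g Gf Gg h \<epsilon> (s \<omega>) (t \<omega>) k" for \<omega>
  have x: "x \<in> M \<rightarrow>\<^sub>M restrict_space borel (subgrad_domain X d)"
    unfolding x_def using Suc by simp
  note xX = restrict_space_borel_mono_measurable[OF x subgrad_domain_subset]
  have [measurable]: "x \<in> borel_measurable M"
    using x by (simp add: measurable_restrict_space2_iff)
  note [measurable] = g
  have [measurable]: "(\<lambda>\<omega>. Gf (x \<omega>) (s \<omega> k)) \<in> borel_measurable M"
    by (rule measurable_random_point[OF Gf xX]) (simp add: Suc.prems)
  have [measurable]: "(\<lambda>\<omega>. Gg (x \<omega>) (t \<omega> k)) \<in> borel_measurable M"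
    by (rule measurable_random_point[OF Gg xX]) (simp add: Suc.prems)
  define p where "p \<omega> = (if g (x \<omega>) \<le> \<epsilon> then h *\<^sub>R Gf (x \<omega>) (s \<omega> k) else h *\<^sub>R Gg (x \<omega>) (t \<omega> k))" for \<omega>
  have p: "p \<in> borel_measurable M"
    unfolding p_def by measurable
  have "(\<lambda>\<omega>. mirr X d grad_d (x \<omega>) (p \<omega>)) \<in> M \<rightarrow>\<^sub>M restrict_space borel (subgrad_domain X d)"
    using measurable_compose[OF measurable_Pair[OF x p] mirr_measurable] by simp
  moreover have "smd_iterate X d grad_d g Gf Gg h \<epsilon> (s \<omega>) (t \<omega>) (Suc k) = mirr X d grad_d (x \<omega>) (p \<omega>)" for \<omega>
    by (simp add: x_def p_def Let_def)
  ultimately show ?case by simp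
qed

text \<open>
  The random index set of productive steps is removed by writing the average as a quotient of sums
  over all \<open>k < N\<close> of terms that vanish on non-productive steps.
\<close>

lemma smd_success_event_measurable:
  assumes f: "continuous_on X f" and g: "g \<in> borel_measurable borel"
    and x: "\<And>k. k < N \<Longrightarrow> (\<lambda>\<omega>. smd_iterate X d grad_d g Gf Gg (\<epsilon> / max (Mf\<^sup>2) (Mg\<^sup>2)) \<epsilon> (s \<omega>) (t \<omega>) k)
      \<in> borel_measurable M"
  shows "{\<omega> \<in> space M. \<exists>x_bar. smd_output X d grad_d g Gf Gg Mf Mg \<epsilon> N (s \<omega>) (t \<omega>) = Some x_bar \<and>
    f x_bar - c \<le> \<epsilon> \<and> g x_bar \<le> \<epsilon>} \<in> sets M"
proof -
  define it where "it k \<omega> = smd_iterate X d grad_d g Gf Gg (\<epsilon> / max (Mf\<^sup>2) (Mg\<^sup>2)) \<epsilon> (s \<omega>) (t \<omega>) k" for k \<omega>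
  define I where "I \<omega> = {k. k < N \<and> g (it k \<omega>) \<le> \<epsilon>}" for \<omega>
  define m where "m \<omega> = (1 / real (card (I \<omega>))) *\<^sub>R (\<Sum>i\<in>I \<omega>. it i \<omega>)" for \<omega>
  \<comment> \<open>A feasible default output, so that \<open>f\<close>, assumed continuous on \<open>X\<close>, is applied to points of \<open>X\<close>.\<close>
  obtain z where z: "z \<in> X" using X_nonempty by blast
  define out where "out \<omega> = (if I \<omega> = {} then z else m \<omega>)" for \<omega>
  note [measurable] = g
  have it[measurable]: "it k \<in> borel_measurable M" if "k < N" for k
    unfolding it_def by (rule x[OF that])
  have nonempty[measurable]: "Measurable.pred M (\<lambda>\<omega>. I \<omega> = {})"
  proof -
    have "(I \<omega> = {}) \<longleftrightarrow> (\<forall>k\<in>{..<N}. \<not> g (it k \<omega>) \<le> \<epsilon>)" for \<omega>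
      by (auto simp: I_def)
    moreover have "Measurable.pred M (\<lambda>\<omega>. \<forall>k\<in>{..<N}. \<not> g (it k \<omega>) \<le> \<epsilon>)"
      by measurable
    ultimately show ?thesis by simp
  qed
  have sum_I: "(\<Sum>i\<in>I \<omega>. a i) = (\<Sum>k<N. if g (it k \<omega>) \<le> \<epsilon> then a k else 0)"
    for a :: "nat \<Rightarrow> 'z::comm_monoid_add" and \<omega>
  proof -
    have "I \<omega> = {..<N} \<inter> {k. g (it k \<omega>) \<le> \<epsilon>}" by (auto simp: I_def)
    then show ?thesis by (simp add: sum.inter_restrict)
  qed
  have "real (card (I \<omega>)) = (\<Sum>k<N. if g (it k \<omega>) \<le> \<epsilon> then 1 else 0)" for \<omega>
    using sum_I[of "\<lambda>_. 1 :: real" \<omega>] by simp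
  then have m_eq: "m \<omega> = (1 / (\<Sum>k<N. if g (it k \<omega>) \<le> \<epsilon> then 1 else 0))
      *\<^sub>R (\<Sum>k<N. if g (it k \<omega>) \<le> \<epsilon> then it k \<omega> else 0)" for \<omega>
    by (simp add: m_def sum_I)
  have "Measurable.pred M (\<lambda>\<omega>. g (it k \<omega>) \<le> \<epsilon>)" if "k < N" for k
    using that by measurable
  then have "m \<in> borel_measurable M"
    unfolding m_eq[abs_def]
    by (intro borel_measurable_scaleR borel_measurable_divide borel_measurable_sum
        measurable_If borel_measurable_const) (auto intro: it)
  then have out: "out \<in> borel_measurable M"
    unfolding out_def by measurable
  moreover have outX: "out \<omega> \<in> X" for \<omega>
  proof (cases "I \<omega> = {}")
    case True
    then show ?thesis using z by (simp add: out_def)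
  next
    case False
    have "m \<omega> \<in> X"
      unfolding m_def
      by (rule average_in_convex[OF _ False X(2)]) (auto simp: I_def it_def smd_iterate_in_X)
    then show ?thesis using False by (simp add: out_def)
  qed
  ultimately have "out \<in> M \<rightarrow>\<^sub>M restrict_space borel X"
    by (auto simp: measurable_restrict_space2_iff)
  then have [measurable]: "(\<lambda>\<omega>. f (out \<omega>)) \<in> borel_measurable M"
    by (rule measurable_compose[OF _ borel_measurable_continuous_on_restrict[OF f]])
  note [measurable] = out
  have "smd_output X d grad_d g Gf Gg Mf Mg \<epsilon> N (s \<omega>) (t \<omega>) = (if I \<omega> = {} then None else Some (out \<omega>))" for \<omega>
  proof -
    have "smd_output X d grad_d g Gf Gg Mf Mg \<epsilon> N (s \<omega>) (t \<omega>) = (if I \<omega> \<noteq> {} then Some (m \<omega>) else None)"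
      by (simp only: smd_output_def Let_def m_def I_def it_def)
    then show ?thesis by (simp add: out_def)
  qed
  then have "{\<omega> \<in> space M. \<exists>x_bar. smd_output X d grad_d g Gf Gg Mf Mg \<epsilon> N (s \<omega>) (t \<omega>) = Some x_bar \<and>
      f x_bar - c \<le> \<epsilon> \<and> g x_bar \<le> \<epsilon>}
    = {\<omega> \<in> space M. \<not> I \<omega> = {} \<and> f (out \<omega>) - c \<le> \<epsilon> \<and> g (out \<omega>) \<le> \<epsilon>}"
    by auto
  also have "\<dots> \<in> sets M" by measurable
  finally show ?thesis .
qed

end

section \<open>Concentration for sums adapted to independent realizations\<close>

text \<open>
  If \<open>U\<close> and \<open>V\<close> have a product law, Tonelli's theorem lets \<open>V\<close> be averaged first with the value of \<open>U\<close>
  frozen; this replaces conditioning on \<open>U\<close>.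
\<close>

lemma (in prob_space) nn_integral_product_law:
  assumes [measurable]: "U \<in> M \<rightarrow>\<^sub>M A" "V \<in> M \<rightarrow>\<^sub>M B"
    and joint: "distr M A U \<Otimes>\<^sub>M distr M B V = distr M (A \<Otimes>\<^sub>M B) (\<lambda>\<omega>. (U \<omega>, V \<omega>))"
    and F[measurable]: "case_prod F \<in> borel_measurable (A \<Otimes>\<^sub>M B)"
  shows "(\<integral>\<^sup>+\<omega>. F (U \<omega>) (V \<omega>) \<partial>M) = (\<integral>\<^sup>+\<omega>. (\<integral>\<^sup>+\<omega>'. F (U \<omega>) (V \<omega>') \<partial>M) \<partial>M)"
proof -
  interpret V: prob_space "distr M B V" by (rule prob_space_distr) measurable
  have "(\<integral>\<^sup>+\<omega>. F (U \<omega>) (V \<omega>) \<partial>M) = (\<integral>\<^sup>+z. case_prod F z \<partial>(distr M A U \<Otimes>\<^sub>M distr M B V))"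
    unfolding joint by (subst nn_integral_distr) auto
  also have "\<dots> = (\<integral>\<^sup>+u. (\<integral>\<^sup>+v. F u v \<partial>distr M B V) \<partial>distr M A U)"
    by (subst V.nn_integral_fst[symmetric]) auto
  also have "\<dots> = (\<integral>\<^sup>+\<omega>. (\<integral>\<^sup>+v. F (U \<omega>) v \<partial>distr M B V) \<partial>M)"
    by (subst nn_integral_distr) (auto intro!: V.borel_measurable_nn_integral)
  also have "\<dots> = (\<integral>\<^sup>+\<omega>. (\<integral>\<^sup>+\<omega>'. F (U \<omega>) (V \<omega>') \<partial>M) \<partial>M)"
  proof (rule nn_integral_cong)
    fix \<omega> assume "\<omega> \<in> space M"
    then have "U \<omega> \<in> space A" by (rule measurable_space[rotated]) measurable
    then have "(\<lambda>v. F (U \<omega>) v) \<in> borel_measurable B" by measurable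
    then show "(\<integral>\<^sup>+v. F (U \<omega>) v \<partial>distr M B V) = (\<integral>\<^sup>+\<omega>'. F (U \<omega>) (V \<omega>') \<partial>M)"
      by (intro nn_integral_distr) auto
  qed
  finally show ?thesis .
qed

text \<open>
  A bound whose exceptional null set depends on the point \<open>u\<close> holds almost surely at the random point
  \<open>U\<close> as well, since the exceptional event has probability zero in every section.
\<close>

lemma (in prob_space) AE_product_law:
  assumes [measurable]: "U \<in> M \<rightarrow>\<^sub>M A" "V \<in> M \<rightarrow>\<^sub>M B"
    and joint: "distr M A U \<Otimes>\<^sub>M distr M B V = distr M (A \<Otimes>\<^sub>M B) (\<lambda>\<omega>. (U \<omega>, V \<omega>))"
    and Q[measurable]: "Measurable.pred (A \<Otimes>\<^sub>M B) (case_prod Q)"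
    and sections: "\<And>u. u \<in> space A \<Longrightarrow> AE \<omega> in M. Q u (V \<omega>)"
  shows "AE \<omega> in M. Q (U \<omega>) (V \<omega>)"
proof -
  define F :: "'b \<Rightarrow> 'c \<Rightarrow> ennreal" where "F u v = (if Q u v then 0 else 1)" for u v
  have F: "case_prod F \<in> borel_measurable (A \<Otimes>\<^sub>M B)"
    unfolding F_def by measurable
  have "(\<integral>\<^sup>+\<omega>. F (U \<omega>) (V \<omega>) \<partial>M) = (\<integral>\<^sup>+\<omega>. (\<integral>\<^sup>+\<omega>'. F (U \<omega>) (V \<omega>') \<partial>M) \<partial>M)"
    by (rule nn_integral_product_law[OF assms(1-3) F])
  also have "\<dots> = (\<integral>\<^sup>+\<omega>. 0 \<partial>M)"
  proof (rule nn_integral_cong)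
    fix \<omega> assume "\<omega> \<in> space M"
    then have "U \<omega> \<in> space A" by (rule measurable_space[rotated]) measurable
    then have "AE \<omega>' in M. F (U \<omega>) (V \<omega>') = 0"
      using sections by (auto simp: F_def elim: eventually_mono)
    then have "(\<integral>\<^sup>+\<omega>'. F (U \<omega>) (V \<omega>') \<partial>M) = (\<integral>\<^sup>+\<omega>'. 0 \<partial>M)"
      by (rule nn_integral_cong_AE)
    then show "(\<integral>\<^sup>+\<omega>'. F (U \<omega>) (V \<omega>') \<partial>M) = 0" by simp
  qed
  finally have "(\<integral>\<^sup>+\<omega>. F (U \<omega>) (V \<omega>) \<partial>M) = 0" by simp
  moreover have "(\<lambda>\<omega>. F (U \<omega>) (V \<omega>)) \<in> borel_measurable M"
    using F by measurable
  ultimately have "AE \<omega> in M. F (U \<omega>) (V \<omega>) = 0"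
    by (simp add: nn_integral_0_iff_AE)
  then show ?thesis
    by eventually_elim (auto simp: F_def split: if_splits)
qed

text \<open>
  The history and the present realization take values in different spaces, and their independence
  is used in the form of a product law.  It comes from the independence of the blocks \<open>{..<k}\<close> and
  \<open>{k}\<close> of the family.
\<close>

lemma (in prob_space) indep_vars_past_present_law:
  fixes k N :: nat
  assumes indep: "indep_vars (\<lambda>_. A) Y {..<N}" and k: "k < N"
  defines "U \<equiv> \<lambda>\<omega>. \<lambda>i\<in>{..<k}. Y i \<omega>"
  shows "U \<in> M \<rightarrow>\<^sub>M PiM {..<k} (\<lambda>_. A)" and "Y k \<in> M \<rightarrow>\<^sub>M A"
    and "distr M (PiM {..<k} (\<lambda>_. A)) U \<Otimes>\<^sub>M distr M A (Y k)
      = distr M (PiM {..<k} (\<lambda>_. A) \<Otimes>\<^sub>M A) (\<lambda>\<omega>. (U \<omega>, Y k \<omega>))"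
proof -
  let ?V = "\<lambda>\<omega>. \<lambda>i\<in>{k}. Y i \<omega>"
  let ?P = "PiM {..<k} (\<lambda>_. A)" and ?Q = "PiM {k} (\<lambda>_. A)"
  have "indep_var ?P U ?Q ?V"
    unfolding U_def by (rule indep_var_restrict[OF indep]) (use k in auto)
  then have U[measurable]: "U \<in> M \<rightarrow>\<^sub>M ?P" and V[measurable]: "?V \<in> M \<rightarrow>\<^sub>M ?Q"
    and joint: "distr M ?P U \<Otimes>\<^sub>M distr M ?Q ?V = distr M (?P \<Otimes>\<^sub>M ?Q) (\<lambda>\<omega>. (U \<omega>, ?V \<omega>))"
    unfolding indep_var_distribution_eq by auto
  show "U \<in> M \<rightarrow>\<^sub>M ?P" by fact
  show Yk[measurable]: "Y k \<in> M \<rightarrow>\<^sub>M A"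
    using indep k unfolding indep_vars_def by auto
  have comp[measurable]: "(\<lambda>h. h k) \<in> ?Q \<rightarrow>\<^sub>M A"
    by (rule measurable_component_singleton) simp
  have Y: "distr (distr M ?Q ?V) A (\<lambda>h. h k) = distr M A (Y k)"
    by (subst distr_distr[OF comp V]) (simp add: comp_def)
  interpret Y: prob_space "distr M A (Y k)"
    by (rule prob_space_distr) measurable
  have fin: "sigma_finite_measure (distr (distr M ?Q ?V) A (\<lambda>h. h k))"
    unfolding Y by unfold_locales
  have "distr M ?P U \<Otimes>\<^sub>M distr M A (Y k)
      = distr (distr M ?P U) ?P (\<lambda>x. x) \<Otimes>\<^sub>M distr (distr M ?Q ?V) A (\<lambda>h. h k)"
    unfolding Y by (simp add: distr_id2)
  also have "\<dots> = distr (distr M ?P U \<Otimes>\<^sub>M distr M ?Q ?V) (?P \<Otimes>\<^sub>M A) (\<lambda>(x, h). (x, h k))"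
    by (rule pair_measure_distr[OF _ _ fin]) simp_all
  also have "\<dots> = distr M (?P \<Otimes>\<^sub>M A) (\<lambda>\<omega>. (U \<omega>, Y k \<omega>))"
    unfolding joint by (subst distr_distr) (auto simp: comp_def)
  finally show "distr M ?P U \<Otimes>\<^sub>M distr M A (Y k) = distr M (?P \<Otimes>\<^sub>M A) (\<lambda>\<omega>. (U \<omega>, Y k \<omega>))" .
qed

text \<open>
  The \<open>k\<close>-th summand is a function \<open>Z k\<close> of the history \<open>U k\<close> and of the fresh realization \<open>Y k\<close>, compensated by
  its mean \<open>e k\<close> for frozen history.  Hoeffding's lemma for frozen history bounds the exponential moment
  of each compensated term by \<open>exp (l\<^sup>2 c\<^sup>2 / 2)\<close>; averaging over the present before the past multiplies
  these factors, and the Chernoff bound follows.  The last conclusion is the measurability that is needed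
  to speak of the complementary event.
\<close>

lemma (in prob_space) azuma_hoeffding_adapted:
  fixes Z :: "nat \<Rightarrow> (nat \<Rightarrow> 'b) \<Rightarrow> 'b \<Rightarrow> real"
  assumes indep: "indep_vars (\<lambda>_. A) Y {..<N}"
    and Z: "\<And>k. k < N \<Longrightarrow> case_prod (Z k) \<in> borel_measurable (PiM {..<k} (\<lambda>_. A) \<Otimes>\<^sub>M A)"
    and bound: "\<And>k u. k < N \<Longrightarrow> u \<in> space (PiM {..<k} (\<lambda>_. A)) \<Longrightarrow>
      AE \<omega> in M. \<bar>Z k u (Y k \<omega>)\<bar> \<le> c"
    and c: "c > 0" and N: "N > 0" and t: "t > 0"
  defines "U \<equiv> \<lambda>k \<omega>. \<lambda>i\<in>{..<k}. Y i \<omega>"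
  defines "e \<equiv> \<lambda>k u. expectation (\<lambda>\<omega>'. Z k u (Y k \<omega>'))"
  shows "prob {\<omega>\<in>space M. (\<Sum>k<N. e k (U k \<omega>) - Z k (U k \<omega>) (Y k \<omega>)) \<ge> t}
    \<le> exp (- (t\<^sup>2 / (2 * real N * c\<^sup>2)))"
    and "(\<lambda>\<omega>. \<Sum>k<N. e k (U k \<omega>) - Z k (U k \<omega>) (Y k \<omega>)) \<in> borel_measurable M"
proof -
  have Y: "Y k \<in> M \<rightarrow>\<^sub>M A" if "k < N" for k
    using indep that unfolding indep_vars_def by auto
  have U: "U k \<in> M \<rightarrow>\<^sub>M PiM {..<k} (\<lambda>_. A)" if "k \<le> N" for k
    unfolding U_def using Y that by (intro measurable_restrict) auto
  have e: "e k \<in> borel_measurable (PiM {..<k} (\<lambda>_. A))" if "k < N" for k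
  proof -
    note [measurable] = Z[OF that] Y[OF that]
    show ?thesis unfolding e_def by measurable
  qed
  define D where "D k u y = e k u - Z k u y" for k u y
  have D: "case_prod (D k) \<in> borel_measurable (PiM {..<k} (\<lambda>_. A) \<Otimes>\<^sub>M A)" if "k < N" for k
  proof -
    note [measurable] = Z[OF that] e[OF that]
    show ?thesis unfolding D_def by measurable
  qed
  have D_mgf: "(\<integral>\<^sup>+\<omega>. ennreal (exp (l * D k u (Y k \<omega>))) \<partial>M) \<le> ennreal (exp (l\<^sup>2 * c\<^sup>2 / 2))"
    if "k < N" "u \<in> space (PiM {..<k} (\<lambda>_. A))" "l > 0" for k u l
  proof -
    note [measurable] = Z[OF that(1)] Y[OF that(1)]
    have [measurable]: "(\<lambda>\<omega>. Z k u (Y k \<omega>)) \<in> borel_measurable M"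
      using that(2) by measurable
    \<comment> \<open>The uncentred term has range \<open>2 c\<close>; centring first would cost a factor \<open>4\<close> in the exponent.\<close>
    interpret interval_bounded_random_variable M "\<lambda>\<omega>. - Z k u (Y k \<omega>)" "-c" c
    proof
      show "AE \<omega> in M. - Z k u (Y k \<omega>) \<in> {-c..c}"
        using bound[OF that(1,2)] by eventually_elim auto
    qed measurable
    have "(\<integral>\<^sup>+\<omega>. ennreal (exp (l * (- Z k u (Y k \<omega>) - expectation (\<lambda>\<omega>. - Z k u (Y k \<omega>))))) \<partial>M)
      \<le> ennreal (exp (l\<^sup>2 * (c - (- c))\<^sup>2 / 8))"
      by (rule Hoeffdings_lemma_nn_integral) fact
    then show ?thesis by (simp add: D_def e_def power2_eq_square algebra_simps)
  qed
  have U_restrict: "restrict (U n \<omega>) {..<k} = U k \<omega>" if "k \<le> n" for n k \<omega>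
    using that by (auto simp: U_def fun_eq_iff)
  define W where "W n u = (\<Sum>k<n. D k (restrict u {..<k}) (u k))" for n u
  have W: "W n \<in> borel_measurable (PiM {..<n} (\<lambda>_. A))" if "n \<le> N" for n
    unfolding W_def
  proof (rule borel_measurable_sum)
    fix k assume k: "k \<in> {..<n}"
    then have "(\<lambda>u. (restrict u {..<k}, u k)) \<in> PiM {..<n} (\<lambda>_. A) \<rightarrow>\<^sub>M PiM {..<k} (\<lambda>_. A) \<Otimes>\<^sub>M A"
      by (intro measurable_Pair measurable_restrict_subset measurable_component_singleton) auto
    from measurable_compose[OF this D] k that
    show "(\<lambda>u. D k (restrict u {..<k}) (u k)) \<in> borel_measurable (PiM {..<n} (\<lambda>_. A))" by auto
  qed
  have W_U: "W n (U n \<omega>) = (\<Sum>k<n. D k (U k \<omega>) (Y k \<omega>))" for n \<omega>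
    unfolding W_def
  proof (rule sum.cong)
    fix k assume "k \<in> {..<n}"
    moreover from this have "U n \<omega> k = Y k \<omega>" by (simp add: U_def)
    ultimately show "D k (restrict (U n \<omega>) {..<k}) (U n \<omega> k) = D k (U k \<omega>) (Y k \<omega>)"
      by (simp add: U_restrict)
  qed simp
  have mgf: "(\<integral>\<^sup>+\<omega>. ennreal (exp (l * W n (U n \<omega>))) \<partial>M) \<le> ennreal (exp (real n * (l\<^sup>2 * c\<^sup>2 / 2)))"
    if "n \<le> N" "l > 0" for n l
    using that(1)
  proof (induction n)
    case 0
    then show ?case by (simp add: W_def emeasure_space_1)
  next
    case (Suc n)
    then have n: "n < N" by simp
    note [measurable] = W[OF less_imp_le[OF n]] D[OF n]
    define F where "F u y = ennreal (exp (l * W n u)) * ennreal (exp (l * D n u y))" for u y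
    have F: "case_prod F \<in> borel_measurable (PiM {..<n} (\<lambda>_. A) \<Otimes>\<^sub>M A)"
      unfolding F_def by measurable
    have "(\<integral>\<^sup>+\<omega>. ennreal (exp (l * W (Suc n) (U (Suc n) \<omega>))) \<partial>M) = (\<integral>\<^sup>+\<omega>. F (U n \<omega>) (Y n \<omega>) \<partial>M)"
      by (simp add: W_U F_def exp_add distrib_left ennreal_mult)
    also have "\<dots> = (\<integral>\<^sup>+\<omega>. (\<integral>\<^sup>+\<omega>'. F (U n \<omega>) (Y n \<omega>') \<partial>M) \<partial>M)"
      unfolding U_def
      by (rule nn_integral_product_law[OF indep_vars_past_present_law[OF indep n] F])
    also have "\<dots> \<le> (\<integral>\<^sup>+\<omega>. ennreal (exp (l * W n (U n \<omega>))) * ennreal (exp (l\<^sup>2 * c\<^sup>2 / 2)) \<partial>M)"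
    proof (rule nn_integral_mono)
      fix \<omega> assume "\<omega> \<in> space M"
      then have u: "U n \<omega> \<in> space (PiM {..<n} (\<lambda>_. A))"
        using U[of n] n by (auto dest: measurable_space)
      note [measurable] = Y[OF n] D[OF n]
      have "(\<lambda>\<omega>'. ennreal (exp (l * D n (U n \<omega>) (Y n \<omega>')))) \<in> borel_measurable M"
        using u by measurable
      then have "(\<integral>\<^sup>+\<omega>'. F (U n \<omega>) (Y n \<omega>') \<partial>M)
        = ennreal (exp (l * W n (U n \<omega>))) * (\<integral>\<^sup>+\<omega>'. ennreal (exp (l * D n (U n \<omega>) (Y n \<omega>'))) \<partial>M)"
        unfolding F_def by (rule nn_integral_cmult)
      also have "\<dots> \<le> ennreal (exp (l * W n (U n \<omega>))) * ennreal (exp (l\<^sup>2 * c\<^sup>2 / 2))"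
        by (intro mult_left_mono D_mgf n u that) auto
      finally show "(\<integral>\<^sup>+\<omega>'. F (U n \<omega>) (Y n \<omega>') \<partial>M) \<le> \<dots>" .
    qed
    also have "\<dots> = (\<integral>\<^sup>+\<omega>. ennreal (exp (l * W n (U n \<omega>))) \<partial>M) * ennreal (exp (l\<^sup>2 * c\<^sup>2 / 2))"
      using U[OF less_imp_le[OF n]] by (intro nn_integral_multc) measurable
    also have "\<dots> \<le> ennreal (exp (real n * (l\<^sup>2 * c\<^sup>2 / 2))) * ennreal (exp (l\<^sup>2 * c\<^sup>2 / 2))"
      using Suc.IH n by (intro mult_right_mono) auto
    also have "\<dots> = ennreal (exp (real (Suc n) * (l\<^sup>2 * c\<^sup>2 / 2)))"
      by (simp flip: ennreal_mult exp_add add: algebra_simps)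
    finally show ?case .
  qed
  have meas: "(\<lambda>\<omega>. W N (U N \<omega>)) \<in> borel_measurable M"
    using W[of N] U[of N] by measurable
  then show "(\<lambda>\<omega>. \<Sum>k<N. e k (U k \<omega>) - Z k (U k \<omega>) (Y k \<omega>)) \<in> borel_measurable M"
    by (simp add: W_U D_def)
  \<comment> \<open>The minimizer of the exponent \<open>N l\<^sup>2 c\<^sup>2 / 2 - l t\<close> of the Chernoff bound.\<close>
  define l where "l = t / (real N * c\<^sup>2)"
  have l: "l > 0" using t N c by (simp add: l_def)
  have "emeasure M {\<omega>\<in>space M. W N (U N \<omega>) \<ge> t}
      \<le> ennreal (exp (- l * t)) * (\<integral>\<^sup>+\<omega>\<in>space M. ennreal (exp (l * W N (U N \<omega>))) \<partial>M)"
    using meas by (intro Chernoff_ineq_nn_integral_ge l) auto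
  also have "(\<integral>\<^sup>+\<omega>\<in>space M. ennreal (exp (l * W N (U N \<omega>))) \<partial>M)
      = (\<integral>\<^sup>+\<omega>. ennreal (exp (l * W N (U N \<omega>))) \<partial>M)"
    by (intro nn_integral_cong) auto
  also have "ennreal (exp (- l * t)) * \<dots> \<le> ennreal (exp (- l * t)) * ennreal (exp (real N * (l\<^sup>2 * c\<^sup>2 / 2)))"
    by (intro mult_left_mono mgf l) auto
  also have "\<dots> = ennreal (exp (- l * t + real N * (l\<^sup>2 * c\<^sup>2 / 2)))"
    by (simp flip: ennreal_mult exp_add)
  also have "- l * t + real N * (l\<^sup>2 * c\<^sup>2 / 2) = - (t\<^sup>2 / (2 * real N * c\<^sup>2))"
    using N c by (simp add: l_def field_simps power2_eq_square)
  finally show "prob {\<omega>\<in>space M. (\<Sum>k<N. e k (U k \<omega>) - Z k (U k \<omega>) (Y k \<omega>)) \<ge> t}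
    \<le> exp (- (t\<^sup>2 / (2 * real N * c\<^sup>2)))"
    by (simp add: W_U D_def emeasure_eq_measure)
qed

lemma (in prob_space) same_law_expectation_functional:
  fixes F :: "'s \<Rightarrow> 'b::euclidean_space \<Rightarrow>\<^sub>L real"
  assumes law: "distr M S \<xi>' = distr M S \<xi>"
    and [measurable]: "\<xi>' \<in> M \<rightarrow>\<^sub>M S" "\<xi> \<in> M \<rightarrow>\<^sub>M S" "F \<in> borel_measurable S"
    and int: "integrable M (\<lambda>\<omega>. F (\<xi> \<omega>))"
  shows "expectation (\<lambda>\<omega>. blinfun_apply (F (\<xi>' \<omega>)) v) = blinfun_apply (expectation (\<lambda>\<omega>. F (\<xi> \<omega>))) v"
proof -
  have [measurable]: "(\<lambda>s. blinfun_apply (F s) v) \<in> borel_measurable S"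
    by (intro borel_measurable_blinfun_apply) auto
  have "expectation (\<lambda>\<omega>. blinfun_apply (F (\<xi>' \<omega>)) v) = (\<integral>s. blinfun_apply (F s) v \<partial>distr M S \<xi>')"
    by (subst integral_distr) auto
  also have "\<dots> = expectation (\<lambda>\<omega>. blinfun_apply (F (\<xi> \<omega>)) v)"
    unfolding law by (subst integral_distr) auto
  also have "\<dots> = blinfun_apply (expectation (\<lambda>\<omega>. F (\<xi> \<omega>))) v"
    by (rule integral_bounded_linear[OF blinfun.bounded_linear_left int])
  finally show ?thesis .
qed

lemma (in prob_space) same_law_AE:
  assumes law: "distr M S \<xi>' = distr M S \<xi>"
    and \<xi>': "\<xi>' \<in> M \<rightarrow>\<^sub>M S" and \<xi>: "\<xi> \<in> M \<rightarrow>\<^sub>M S" and Q: "Measurable.pred S Q"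
    and AE: "AE \<omega> in M. Q (\<xi> \<omega>)"
  shows "AE \<omega> in M. Q (\<xi>' \<omega>)"
proof -
  have Q': "{s \<in> space S. Q s} \<in> sets S" using Q by (simp add: pred_def)
  have "AE s in distr M S \<xi>'. Q s"
    unfolding law using AE by (simp add: AE_distr_iff[OF \<xi> Q'])
  then show ?thesis by (simp add: AE_distr_iff[OF \<xi>' Q'])
qed

section \<open>Accuracy with high probability\<close>

text \<open>
  With \<open>A = M\<^sup>2 \<Theta>\<^sup>2 / \<epsilon>\<^sup>2\<close> and \<open>L = ln (1 / \<sigma>)\<close>, the deviation left for the noise is \<open>\<epsilon> (n / 2 - A)\<close>, and the
  tail bound is at most \<open>\<sigma>\<close> when its square is at least \<open>\<epsilon>\<^sup>2 \<cdot> 4 n A L\<close>.  The bound \<open>L \<ge> 2 / 3\<close>, a consequence of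
  \<open>\<sigma> < 1 / 2\<close>, makes \<open>A\<close> small against \<open>n\<close>.
\<close>

lemma iteration_count_suffices:
  fixes A L n :: real
  assumes A: "A > 0" and L: "L \<ge> 2 / 3" and n: "n \<ge> 70 * A * L"
  shows "n / 2 - A > 0" and "4 * n * A * L \<le> (n / 2 - A)\<^sup>2"
proof -
  have "A * (2 / 3) \<le> A * L" using A L by (intro mult_left_mono) auto
  then have *: "n / 2 - A \<ge> n / 4" and n_pos: "n > 0"
    using n A by linarith+
  then show "n / 2 - A > 0" by linarith
  have "n * (70 * A * L) \<le> n * n" using n n_pos by (intro mult_left_mono) auto
  then have "4 * n * A * L \<le> (n / 4)\<^sup>2"
    using n_pos A L by (simp add: power2_eq_square) 
  also have "\<dots> \<le> (n / 2 - A)\<^sup>2" using * n_pos by (intro power_mono) auto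
  finally show "4 * n * A * L \<le> (n / 2 - A)\<^sup>2" .
qed

theorem theorem7:
  fixes nrm :: "'a::euclidean_space \<Rightarrow> real"
    and X :: "'a set"
    and f g d :: "'a \<Rightarrow> real"
    and grad_d :: "'a \<Rightarrow> 'a \<Rightarrow>\<^sub>L real"
    and P :: "'w measure"
    and S :: "'s measure" and T :: "'t measure"
    and \<xi> :: "'w \<Rightarrow> 's" and \<zeta> :: "'w \<Rightarrow> 't"
    and \<xi>s :: "nat \<Rightarrow> 'w \<Rightarrow> 's" and \<zeta>s :: "nat \<Rightarrow> 'w \<Rightarrow> 't"
    and Gf :: "'a \<Rightarrow> 's \<Rightarrow> 'a \<Rightarrow>\<^sub>L real" and Gg :: "'a \<Rightarrow> 't \<Rightarrow> 'a \<Rightarrow>\<^sub>L real"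
    and x_opt :: 'a
    and Mf Mg \<Theta>0 \<epsilon> \<sigma> :: real
    and N :: nat
  assumes nrm: "is_norm nrm"
    and X: "closed X" "convex X"
    and f_convex: "convex_on X f"
    and g_convex: "convex_on UNIV g"
    and regular: "\<exists>x\<in>rel_interior X. g x < 0"
    and solution: "is_arg_min f (\<lambda>x. x \<in> X \<and> g x \<le> 0) x_opt"
    and prox: "prox_function nrm X d grad_d"
    and f_Lipschitz: "\<forall>x\<in>X. \<forall>y\<in>X. \<bar>f x - f y\<bar> \<le> Mf * nrm (x - y)"
    and g_Lipschitz: "\<forall>x\<in>X. \<forall>y\<in>X. \<bar>g x - g y\<bar> \<le> Mg * nrm (x - y)"
    and M_pos: "max (Mf\<^sup>2) (Mg\<^sup>2) > 0"
    and P: "prob_space P"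
    and random_vectors: "\<xi> \<in> P \<rightarrow>\<^sub>M S" "\<zeta> \<in> P \<rightarrow>\<^sub>M T"
    and Gf_measurable: "(\<lambda>(x, s). Gf x s) \<in> borel_measurable (restrict_space borel X \<Otimes>\<^sub>M S)"
    and Gg_measurable: "(\<lambda>(x, t). Gg x t) \<in> borel_measurable (restrict_space borel X \<Otimes>\<^sub>M T)"
    and Gf_bounded: "\<forall>x\<in>X. AE \<omega> in P. dual_norm nrm (Gf x (\<xi> \<omega>)) \<le> Mf"
    and Gg_bounded: "\<forall>x\<in>X. AE \<omega> in P. dual_norm nrm (Gg x (\<zeta> \<omega>)) \<le> Mg"
    and Gf_unbiased: "\<forall>x\<in>X. integrable P (\<lambda>\<omega>. Gf x (\<xi> \<omega>)) \<and>
      prob_space.expectation P (\<lambda>\<omega>. Gf x (\<xi> \<omega>)) \<in> subdifferential X f x"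
    and Gg_unbiased: "\<forall>x\<in>X. integrable P (\<lambda>\<omega>. Gg x (\<zeta> \<omega>)) \<and>
      prob_space.expectation P (\<lambda>\<omega>. Gg x (\<zeta> \<omega>)) \<in> subdifferential UNIV g x"
    and \<Theta>0: "\<Theta>0 > 0" "\<forall>x\<in>subgrad_domain X d. \<forall>y\<in>X. bregman d grad_d x y \<le> \<Theta>0\<^sup>2"
    and \<epsilon>: "\<epsilon> > 0"
    and \<sigma>: "0 < \<sigma>" "\<sigma> < 1 / 2"
    and N: "N = nat \<lceil>70 * (max (Mf\<^sup>2) (Mg\<^sup>2) * \<Theta>0\<^sup>2 / \<epsilon>\<^sup>2) * ln (1 / \<sigma>)\<rceil>"
    and realizations:
      "\<forall>k<N. distr P S (\<xi>s k) = distr P S \<xi>" "\<forall>k<N. distr P T (\<zeta>s k) = distr P T \<zeta>"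
    and independent:
      "prob_space.indep_vars P (\<lambda>_. S \<Otimes>\<^sub>M T) (\<lambda>k \<omega>. (\<xi>s k \<omega>, \<zeta>s k \<omega>)) {..<N}"
  shows "prob_space.prob P {\<omega> \<in> space P. \<exists>x_bar.
      smd_output X d grad_d g Gf Gg Mf Mg \<epsilon> N (\<lambda>k. \<xi>s k \<omega>) (\<lambda>k. \<zeta>s k \<omega>) = Some x_bar \<and>
      f x_bar - f x_opt \<le> \<epsilon> \<and> g x_bar \<le> \<epsilon>} \<ge> 1 - \<sigma>"
proof -
  interpret prob_space P by (rule P)
  interpret bounded_prox_setup nrm X d grad_d \<Theta>0
    using nrm X prox \<Theta>0 by unfold_locales auto

  \<comment> \<open>Both subgradient bounds are replaced by the common bound \<open>M\<close>, for which \<open>h = \<epsilon> / M\<^sup>2\<close>.\<close>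
  define M where "M = sqrt (max (Mf\<^sup>2) (Mg\<^sup>2))"
  have M_sq: "max (Mf\<^sup>2) (Mg\<^sup>2) = M\<^sup>2" and M: "M > 0"
    using M_pos by (auto simp: M_def)
  have "\<bar>Mf\<bar> \<le> M" "\<bar>Mg\<bar> \<le> M"
    unfolding M_def by (auto intro!: real_le_rsqrt)
  then have MfM: "Mf \<le> M" and MgM: "Mg \<le> M" by auto
  define h where "h = \<epsilon> / max (Mf\<^sup>2) (Mg\<^sup>2)"
  have h: "h = \<epsilon> / M\<^sup>2" "h > 0" using M \<epsilon> by (auto simp: h_def M_sq)
  have x_opt: "x_opt \<in> X" "g x_opt \<le> 0"
    using solution by (auto simp: is_arg_min_def)
  have g_meas[measurable]: "g \<in> borel_measurable borel"
    using convex_on_continuous[OF open_UNIV g_convex] by (rule borel_measurable_continuous_onI)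
  have f_cont: "continuous_on X f"
  proof -
    obtain K where K: "K > 0" "\<And>x. nrm x \<le> K * norm x"
      using is_norm_le_norm[OF nrm] by blast
    have "dist (f x) (f y) \<le> (\<bar>Mf\<bar> * K) * dist x y" if "x \<in> X" "y \<in> X" for x y
    proof -
      have "\<bar>f x - f y\<bar> \<le> Mf * nrm (x - y)" using f_Lipschitz that by blast
      also have "\<dots> \<le> \<bar>Mf\<bar> * (K * norm (x - y))"
        using is_norm_nonneg[OF nrm] K(2) by (intro mult_mono) auto
      finally show ?thesis by (simp add: dist_norm mult.assoc)
    qed
    then have "(\<bar>Mf\<bar> * K)-lipschitz_on X f"
      using K(1) by (intro lipschitz_onI) auto
    then show ?thesis by (rule lipschitz_on_continuous_on)
  qed

  define A where "A = S \<Otimes>\<^sub>M T"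
  define Y where "Y k \<omega> = (\<xi>s k \<omega>, \<zeta>s k \<omega>)" for k \<omega>
  have indep: "indep_vars (\<lambda>_. A) Y {..<N}"
    using independent unfolding A_def Y_def[abs_def] .
  have Y: "Y k \<in> P \<rightarrow>\<^sub>M A" if "k < N" for k
    using indep that unfolding indep_vars_def by auto
  have \<xi>s: "\<xi>s k \<in> P \<rightarrow>\<^sub>M S" and \<zeta>s: "\<zeta>s k \<in> P \<rightarrow>\<^sub>M T" if "k < N" for k
    using measurable_compose[OF Y[OF that, unfolded A_def] measurable_fst]
      measurable_compose[OF Y[OF that, unfolded A_def] measurable_snd] by (simp_all add: Y_def)

  \<comment> \<open>The stochastic subgradient used at a point \<open>x\<close>, and the progress that its mean certifies there.\<close>
  define G where "G x y = (if g x \<le> \<epsilon> then Gf x (fst y) else Gg x (snd y))" for x y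
  define gap where "gap x = (if g x \<le> \<epsilon> then f x - f x_opt else g x)" for x
  have G_meas: "(\<lambda>(x, y). G x y) \<in> borel_measurable (restrict_space borel X \<Otimes>\<^sub>M A)"
  proof -
    have [measurable]: "(\<lambda>z. fst z :: 'a) \<in> borel_measurable (restrict_space borel X \<Otimes>\<^sub>M A)"
      using measurable_fst[of "restrict_space borel X" A] by (simp add: measurable_restrict_space2_iff)
    have "(\<lambda>z. Gf (fst z) (fst (snd z))) \<in> borel_measurable (restrict_space borel X \<Otimes>\<^sub>M A)"
      by (rule measurable_random_point[OF Gf_measurable]) (simp_all add: A_def)
    moreover have "(\<lambda>z. Gg (fst z) (snd (snd z))) \<in> borel_measurable (restrict_space borel X \<Otimes>\<^sub>M A)"
      by (rule measurable_random_point[OF Gg_measurable]) (simp_all add: A_def)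
    ultimately show ?thesis
      unfolding G_def split_beta' by measurable
  qed
  have G_bounded: "AE \<omega> in P. dual_norm nrm (G x (Y k \<omega>)) \<le> M" if k: "k < N" and x: "x \<in> X" for k x
  proof -
    have closed: "{p. dual_norm nrm p \<le> c} \<in> sets borel" for c
      by (intro borel_closed closed_dual_norm_le nrm)
    have "AE \<omega> in P. dual_norm nrm (Gf x (\<xi>s k \<omega>)) \<le> Mf"
    proof (rule same_law_AE[OF _ \<xi>s[OF k] random_vectors(1)])
      have "Gf x \<in> borel_measurable S"
        using measurable_random_point[OF Gf_measurable, of "\<lambda>_. x" S "\<lambda>s. s"] x
        by (simp add: measurable_restrict_space2_iff)
      from measurable_sets[OF this closed] show "Measurable.pred S (\<lambda>s. dual_norm nrm (Gf x s) \<le> Mf)"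
        by (simp add: pred_def vimage_def Int_def conj_commute)
    qed (use realizations(1) k Gf_bounded x in auto)
    moreover have "AE \<omega> in P. dual_norm nrm (Gg x (\<zeta>s k \<omega>)) \<le> Mg"
    proof (rule same_law_AE[OF _ \<zeta>s[OF k] random_vectors(2)])
      have "Gg x \<in> borel_measurable T"
        using measurable_random_point[OF Gg_measurable, of "\<lambda>_. x" T "\<lambda>s. s"] x
        by (simp add: measurable_restrict_space2_iff)
      from measurable_sets[OF this closed] show "Measurable.pred T (\<lambda>s. dual_norm nrm (Gg x s) \<le> Mg)"
        by (simp add: pred_def vimage_def Int_def conj_commute)
    qed (use realizations(2) k Gg_bounded x in auto)
    ultimately show ?thesis
      by eventually_elim (use MfM MgM in \<open>auto simp: G_def Y_def\<close>)
  qed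
  have G_mean: "gap x \<le> expectation (\<lambda>\<omega>. blinfun_apply (G x (Y k \<omega>)) (x - x_opt))"
    if k: "k < N" and x: "x \<in> X" for k x
  proof (cases "g x \<le> \<epsilon>")
    case True
    have "Gf x \<in> borel_measurable S"
      using measurable_random_point[OF Gf_measurable, of "\<lambda>_. x" S "\<lambda>s. s"] x
      by (simp add: measurable_restrict_space2_iff)
    then have "expectation (\<lambda>\<omega>. blinfun_apply (Gf x (\<xi>s k \<omega>)) (x - x_opt))
        = blinfun_apply (expectation (\<lambda>\<omega>. Gf x (\<xi> \<omega>))) (x - x_opt)"
      using realizations(1) k Gf_unbiased x
      by (intro same_law_expectation_functional[OF _ \<xi>s[OF k] random_vectors(1)]) auto
    moreover have "f x_opt \<ge> f x + blinfun_apply (expectation (\<lambda>\<omega>. Gf x (\<xi> \<omega>))) (x_opt - x)"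
      using Gf_unbiased x x_opt(1) by (auto simp: subdifferential_def)
    ultimately show ?thesis
      using True by (simp add: gap_def G_def Y_def blinfun.diff_right)
  next
    case False
    have "Gg x \<in> borel_measurable T"
      using measurable_random_point[OF Gg_measurable, of "\<lambda>_. x" T "\<lambda>s. s"] x
      by (simp add: measurable_restrict_space2_iff)
    then have "expectation (\<lambda>\<omega>. blinfun_apply (Gg x (\<zeta>s k \<omega>)) (x - x_opt))
        = blinfun_apply (expectation (\<lambda>\<omega>. Gg x (\<zeta> \<omega>))) (x - x_opt)"
      using realizations(2) k Gg_unbiased x
      by (intro same_law_expectation_functional[OF _ \<zeta>s[OF k] random_vectors(2)]) auto
    moreover have "g x_opt \<ge> g x + blinfun_apply (expectation (\<lambda>\<omega>. Gg x (\<zeta> \<omega>))) (x_opt - x)"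
      using Gg_unbiased x by (auto simp: subdifferential_def)
    ultimately show ?thesis
      using False x_opt(2) by (simp add: gap_def G_def Y_def blinfun.diff_right)
  qed

  \<comment> \<open>\<open>it k\<close> depends on the realizations before step \<open>k\<close> only, hence is independent of \<open>Y k\<close>.\<close>
  define it where "it k u = smd_iterate X d grad_d g Gf Gg h \<epsilon> (\<lambda>j. fst (u j)) (\<lambda>j. snd (u j)) k" for k u
  define U where "U k \<omega> = (\<lambda>i\<in>{..<k}. Y i \<omega>)" for k \<omega>
  define x where "x \<omega> k = smd_iterate X d grad_d g Gf Gg h \<epsilon> (\<lambda>j. \<xi>s j \<omega>) (\<lambda>j. \<zeta>s j \<omega>) k" for \<omega> k
  have it_U: "it k (U k \<omega>) = x \<omega> k" for k \<omega>
    unfolding it_def x_def by (rule smd_iterate_cong) (auto simp: U_def Y_def)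
  have itX: "it k u \<in> X" for k u
    unfolding it_def by (rule smd_iterate_in_X)
  have it_meas: "it k \<in> PiM {..<k} (\<lambda>_. A) \<rightarrow>\<^sub>M restrict_space borel X" for k
  proof -
    have comp: "(\<lambda>u. u j) \<in> PiM {..<k} (\<lambda>_. A) \<rightarrow>\<^sub>M S \<Otimes>\<^sub>M T" if "j < k" for j
      using that unfolding A_def by (intro measurable_component_singleton) auto
    have "it k \<in> PiM {..<k} (\<lambda>_. A) \<rightarrow>\<^sub>M restrict_space borel (subgrad_domain X d)"
      unfolding it_def[abs_def]
      by (rule smd_iterate_measurable[OF g_meas Gf_measurable Gg_measurable])
        (auto intro: measurable_compose[OF comp measurable_fst] measurable_compose[OF comp measurable_snd])
    then show ?thesis by (rule restrict_space_borel_mono_measurable[OF _ subgrad_domain_subset])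
  qed
  have G_it: "(\<lambda>z. G (it k (fst z)) (snd z)) \<in> borel_measurable (PiM {..<k} (\<lambda>_. A) \<Otimes>\<^sub>M A)" for k
    by (rule measurable_random_point[OF G_meas measurable_compose[OF measurable_fst it_meas] measurable_snd])

  \<comment> \<open>Hoeffding's lemma is applied to \<open>Z\<close>; its bound \<open>c\<close> is \<open>M\<close> times the diameter bound \<open>\<surd>2 \<Theta>0\<close>.\<close>
  define Z where "Z k u y = blinfun_apply (G (it k u) y) (it k u - x_opt)" for k u y
  define c where "c = M * (sqrt 2 * \<Theta>0)"
  have c: "c > 0" using M \<Theta>0(1) by (simp add: c_def)
  have Z_meas: "case_prod (Z k) \<in> borel_measurable (PiM {..<k} (\<lambda>_. A) \<Otimes>\<^sub>M A)" for k
  proof -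
    have "it k \<in> borel_measurable (PiM {..<k} (\<lambda>_. A))"
      using it_meas by (simp add: measurable_restrict_space2_iff)
    then have "(\<lambda>z. it k (fst z) - x_opt) \<in> borel_measurable (PiM {..<k} (\<lambda>_. A) \<Otimes>\<^sub>M A)"
      by measurable
    from borel_measurable_blinfun_apply[OF G_it this] show ?thesis
      by (simp add: Z_def split_beta')
  qed
  have Z_bounded: "AE \<omega> in P. \<bar>Z k u (Y k \<omega>)\<bar> \<le> c" if "k < N" for k u
    using G_bounded[OF that itX[of k u]]
  proof eventually_elim
    case (elim \<omega>)
    have "\<bar>Z k u (Y k \<omega>)\<bar> \<le> M * nrm (it k u - x_opt)"
      unfolding Z_def by (rule dual_norm_pairing[OF nrm elim])
    also have "\<dots> \<le> c"
      unfolding c_def using M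
      by (intro mult_left_mono diameter_le x_opt(1)) (auto simp: it_def smd_iterate_subgrad_domain)
    finally show ?case .
  qed
  define e where "e k u = expectation (\<lambda>\<omega>'. Z k u (Y k \<omega>'))" for k u
  have gap_le: "gap (x \<omega> k) \<le> e k (U k \<omega>)" if "k < N" for k \<omega>
    using G_mean[OF that itX[of k "U k \<omega>"]] by (simp add: e_def Z_def it_U)

  \<comment> \<open>In these terms the choice of \<open>N\<close> gives \<open>N \<ge> 70 B L\<close>.\<close>
  define L where "L = ln (1 / \<sigma>)"
  define B where "B = M\<^sup>2 * \<Theta>0\<^sup>2 / \<epsilon>\<^sup>2"
  have B: "B > 0" using M \<Theta>0(1) \<epsilon> by (simp add: B_def)
  have L: "L \<ge> 2 / 3"
  proof -
    have "ln 2 \<le> L" using \<sigma> by (simp add: L_def field_simps)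
    then show ?thesis using ln2_ge_two_thirds by linarith
  qed
  have NBL: "real N \<ge> 70 * B * L"
    using real_nat_ceiling_ge[of "70 * B * L"] by (simp add: N M_sq B_def L_def)
  note count = iteration_count_suffices[OF B L NBL]
  have N_pos: "N > 0" using count(1) B by (cases N) auto
  define t where "t = \<epsilon> * (real N / 2 - B)"
  have t: "t > 0" using count(1) \<epsilon> by (simp add: t_def)

  \<comment> \<open>The regret bound is \<open>\<epsilon> (B + N / 2)\<close>, so \<open>t\<close> is what remains of the total \<open>N \<epsilon>\<close>.\<close>
  define noise where "noise \<omega> = (\<Sum>k<N. e k (U k \<omega>) - Z k (U k \<omega>) (Y k \<omega>))" for \<omega>
  note azuma = azuma_hoeffding_adapted[OF indep Z_meas Z_bounded c N_pos t, folded U_def e_def]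
  have noise_meas[measurable]: "noise \<in> borel_measurable P"
    using azuma(2) unfolding noise_def[abs_def] .
  have "prob {\<omega>\<in>space P. noise \<omega> \<ge> t} \<le> exp (- (t\<^sup>2 / (2 * real N * c\<^sup>2)))"
    using azuma(1) unfolding noise_def .
  also have "\<dots> \<le> exp (- L)"
  proof -
    have "2 * real N * c\<^sup>2 * L = \<epsilon>\<^sup>2 * (4 * real N * B * L)"
      using \<epsilon> by (simp add: c_def B_def power_mult_distrib field_simps)
    also have "\<dots> \<le> \<epsilon>\<^sup>2 * (real N / 2 - B)\<^sup>2"
      using count(2) by (intro mult_left_mono) auto
    also have "\<dots> = t\<^sup>2"
      by (simp add: t_def power_mult_distrib)
    finally have "L \<le> t\<^sup>2 / (2 * real N * c\<^sup>2)"
      using N_pos c by (simp add: field_simps)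
    then show ?thesis by simp
  qed
  also have "exp (- L) = \<sigma>"
    using \<sigma> by (simp add: L_def ln_div)
  finally have noise_small: "prob {\<omega>\<in>space P. noise \<omega> \<ge> t} \<le> \<sigma>" .

  \<comment> \<open>The bound is assumed at each fixed point; independence carries it to the random iterates.\<close>
  have run_bounded: "AE \<omega> in P. \<forall>k\<in>{..<N}. dual_norm nrm (G (x \<omega> k) (Y k \<omega>)) \<le> M"
  proof (rule AE_finite_allI)
    fix k assume "k \<in> {..<N}"
    then have k: "k < N" by simp
    have "{p. dual_norm nrm p \<le> M} \<in> sets borel"
      by (intro borel_closed closed_dual_norm_le nrm)
    from measurable_sets[OF G_it this]
    have "Measurable.pred (PiM {..<k} (\<lambda>_. A) \<Otimes>\<^sub>M A) (\<lambda>(u, y). dual_norm nrm (G (it k u) y) \<le> M)"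
      by (simp add: pred_def vimage_def Int_def conj_commute split_beta')
    from AE_product_law[OF indep_vars_past_present_law[OF indep k] this G_bounded[OF k itX]]
    show "AE \<omega> in P. dual_norm nrm (G (x \<omega> k) (Y k \<omega>)) \<le> M"
      by (simp add: U_def[symmetric] it_U)
  qed simp

  let ?E = "{\<omega> \<in> space P. \<exists>x_bar.
      smd_output X d grad_d g Gf Gg Mf Mg \<epsilon> N (\<lambda>k. \<xi>s k \<omega>) (\<lambda>k. \<zeta>s k \<omega>) = Some x_bar \<and>
      f x_bar - f x_opt \<le> \<epsilon> \<and> g x_bar \<le> \<epsilon>}"
  have success: "\<omega> \<in> ?E"
    if \<omega>: "\<omega> \<in> space P" "noise \<omega> < t"
      and bounded: "\<forall>k\<in>{..<N}. dual_norm nrm (G (x \<omega> k) (Y k \<omega>)) \<le> M" for \<omega>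
  proof -
    have Z_x: "Z k (U k \<omega>) (Y k \<omega>) = blinfun_apply (G (x \<omega> k) (Y k \<omega>)) (x \<omega> k - x_opt)" for k
      by (simp add: Z_def it_U)
    have "(\<Sum>k<N. gap (x \<omega> k)) \<le> (\<Sum>k<N. e k (U k \<omega>))"
      by (intro sum_mono gap_le) simp
    also have "\<dots> = noise \<omega> + (\<Sum>k<N. Z k (U k \<omega>) (Y k \<omega>))"
      by (simp add: noise_def sum_subtractf)
    also have "\<dots> < t + (\<Sum>k<N. Z k (U k \<omega>) (Y k \<omega>))"
      using \<omega>(2) by simp
    also have "(\<Sum>k<N. Z k (U k \<omega>) (Y k \<omega>)) \<le> \<Theta>0\<^sup>2 / h + real N * (h * M\<^sup>2 / 2)"
      unfolding Z_x
    proof (rule mirror_descent_regret[OF _ _ _ x_opt(1) h(2)])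
      show "x \<omega> k \<in> subgrad_domain X d" for k
        unfolding x_def by (rule smd_iterate_subgrad_domain)
      show "x \<omega> (Suc k) = mirr X d grad_d (x \<omega> k) (h *\<^sub>R G (x \<omega> k) (Y k \<omega>))" for k
        by (simp add: x_def G_def Y_def Let_def)
      show "\<bar>blinfun_apply (G (x \<omega> k) (Y k \<omega>)) v\<bar> \<le> M * nrm v" if "k < N" for k v
        using bounded that by (intro dual_norm_pairing nrm) auto
    qed
    also have "t + (\<Theta>0\<^sup>2 / h + real N * (h * M\<^sup>2 / 2)) = real N * \<epsilon>"
      using M \<epsilon> by (simp add: t_def B_def h(1) field_simps power2_eq_square)
    finally have "(\<Sum>k<N. gap (x \<omega> k)) < real N * \<epsilon>" by simp
    then have "\<exists>x_bar. smd_output X d grad_d g Gf Gg Mf Mg \<epsilon> N (\<lambda>k. \<xi>s k \<omega>) (\<lambda>k. \<zeta>s k \<omega>) = Some x_bar \<and>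
      f x_bar - f x_opt \<le> \<epsilon> \<and> g x_bar \<le> \<epsilon>"
      unfolding gap_def
      by (intro smd_output_eps_optimal[OF X(2) f_convex g_convex, where x = "x \<omega>"])
        (auto simp: x_def[abs_def] h_def smd_iterate_in_X)
    then show ?thesis using \<omega>(1) by simp
  qed

  have "?E \<in> events"
  proof (rule smd_success_event_measurable[OF f_cont g_meas])
    fix k assume k: "k < N"
    have "(\<lambda>\<omega>. smd_iterate X d grad_d g Gf Gg (\<epsilon> / max (Mf\<^sup>2) (Mg\<^sup>2)) \<epsilon> (\<lambda>j. \<xi>s j \<omega>) (\<lambda>j. \<zeta>s j \<omega>) k)
      \<in> P \<rightarrow>\<^sub>M restrict_space borel (subgrad_domain X d)"
      using k by (intro smd_iterate_measurable[OF g_meas Gf_measurable Gg_measurable] \<xi>s \<zeta>s) auto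
    then show "(\<lambda>\<omega>. smd_iterate X d grad_d g Gf Gg (\<epsilon> / max (Mf\<^sup>2) (Mg\<^sup>2)) \<epsilon> (\<lambda>j. \<xi>s j \<omega>) (\<lambda>j. \<zeta>s j \<omega>) k)
      \<in> borel_measurable P"
      by (simp add: measurable_restrict_space2_iff)
  qed
  moreover have "AE \<omega> in P. \<omega> \<in> space P - {\<omega>\<in>space P. noise \<omega> \<ge> t} \<longrightarrow> \<omega> \<in> ?E"
    using run_bounded by eventually_elim (use success in auto)
  ultimately have "prob (space P - {\<omega>\<in>space P. noise \<omega> \<ge> t}) \<le> prob ?E"
    by (rule finite_measure_mono_AE[rotated])
  moreover have "prob (space P - {\<omega>\<in>space P. noise \<omega> \<ge> t}) = 1 - prob {\<omega>\<in>space P. noise \<omega> \<ge> t}"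
    by (rule prob_compl) measurable
  ultimately show ?thesis using noise_small by linarith
qed

end
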